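(* Let $N\geq 1$, $k\geq 1$, and let $\xi=\sum_{i=1}^m\alpha_i\xi_{p_i}\in(\mathbb{C}^N)^{\otimes k}$ be a non-zero linear combination ($\alpha_i\in\mathbb{C}$) of vectors of crossing partitions $p_i\in\mathcal{CR}(k)$ such that all summands have the same set of crossings: $\operatorname{cr}(p_i)=\operatorname{cr}(p_j)$ for all $i,j\in\{1,\dots,m\}$. Then $\langle\mathcal{NC},\xi\rangle=\mathcal{P}$.
   Context: Fix $N$ and write $[k]=\{1,\dots,k\}$. $\mathcal{P}(k)$ is the set of set partitions of $[k]$; $x\sim_p y$ means $x,y$ lie in the same block of $p$. A crossing of $p\in\mathcal{P}(k)$ is a four-element subset $\{\kappa_1<\kappa_2<\kappa_3<\kappa_4\}\subseteq[k]$ with $\kappa_1\sim_p\kappa_3$, $\kappa_2\sim_p\kappa_4$, $\kappa_1\not\sim_p\kappa_2$; $\operatorname{cr}(p)$ is the set of crossings of $p$, and $\mathcal{CR}(k)=\{p\in\mathcal{P}(k):\operatorname{cr}(p)\neq\emptyset\}$. For $p\in\mathcal{P}(k)$, $\xi_p\in(\mathbb{C}^N)^{\otimes k}$ is $\xi_p=\sum e_{i_1}\otimes\cdots\otimes e_{i_k}$, the sum over all $(i_1,\dots,i_k)\in[N]^k$ with $i_x=i_y$ whenever $x\sim_p y$. More generally $\mathcal{P}(k,\ell)$ is the set of partitions of a set of $k$ upper and $\ell$ lower points; for $p\in\mathcal{P}(k,\ell)$ the matrix $T_p\in M_{N^\ell\times N^k}(\mathbb{C})$ has $((i_1,\dots,i_\ell),(j_1,\dots,j_k))$-entry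 $1$ if, writing $j_1,\dots,j_k$ on the upper points and $i_1,\dots,i_\ell$ on the lower points (left to right), points in the same block carry equal indices, and $0$ otherwise. So $\xi_p=T_p$ for $p\in\mathcal{P}(0,k)=\mathcal{P}(k)$. Crossings in $\mathcal{P}(k,\ell)$ are detected by ordering the points as upper points left-to-right followed by lower points right-to-left. A Tannaka--Krein dual (at parameter $N$) is a family $\mathcal{C}$ of linear subspaces $\hom_{\mathcal{C}}(k,\ell)\subseteq M_{N^\ell\times N^k}(\mathbb{C})$, $k,\ell\geq 0$, closed under tensor (Kronecker) products, composition of composable maps, and adjoints, containing $\mathrm{id}_N\in\hom_{\mathcal C}(1,1)$ and the row vector in $\hom_{\mathcal C}(2,0)$ with $(i,j)$-entry $\delta_{i,j}$. $\mathcal{P}$ is given by $\hom_{\mathcal{P}}(k,\ell)=\operatorname{span}\{T_p: p\in\mathcal{P}(k,\ell)\}$, and $\mathcal{NC}$ by $\hom_{\mathcal{NC}}(k,\ell)=\operatorname{span}\{T_p: p\in\mathcal{P}(k,\ell)\text{ non-crossing}\}$. For $\xi\in(\mathbb{C}^N)^{\otimes k}=M_{N^k\times 1}(\mathbb{C})$, $\langle\mathcal{NC},\xi\rangle$ is the smallest Tannaka--Krein dual containing $\mathcal{NC}$ with $\xi\in\hom(0,k)$. *)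

theory Defs
  imports
    "HOL-Library.Disjoint_Sets"
    "Jordan_Normal_Form.VS_Connect"
    "Jordan_Normal_Form.Schur_Decomposition"
begin

section \<open>Partitions and crossings\<close>

definition same_block :: "'a set set \<Rightarrow> 'a \<Rightarrow> 'a \<Rightarrow> bool" where
  "same_block p x y \<longleftrightarrow> (\<exists>B\<in>p. x \<in> B \<and> y \<in> B)"

text \<open>The function \<open>r\<close> gives the positions by which the points are ordered.\<close>

definition is_crossing :: "('a \<Rightarrow> nat) \<Rightarrow> 'a set set \<Rightarrow> 'a \<Rightarrow> 'a \<Rightarrow> 'a \<Rightarrow> 'a \<Rightarrow> bool" where
  "is_crossing r p a b c d \<longleftrightarrow>
     r a < r b \<and> r b < r c \<and> r c < r d \<and>
     same_block p a c \<and> same_block p b d \<and> \<not> same_block p a b"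

definition cr :: "nat set set \<Rightarrow> nat set set" where
  "cr p = {{a, b, c, d} | a b c d. is_crossing (\<lambda>x. x) p a b c d}"

definition CR :: "nat \<Rightarrow> nat set set set" where
  "CR k = {p. partition_on {1..k} p \<and> cr p \<noteq> {}}"

text \<open>Two-row partitions: \<open>Inl x\<close> is the \<open>x\<close>-th upper point and \<open>Inr y\<close> the \<open>y\<close>-th lower
  point, both counted from 1 and from left to right.\<close>

definition two_row_partitions :: "nat \<Rightarrow> nat \<Rightarrow> (nat + nat) set set set" where
  "two_row_partitions k l = {p. partition_on ({1..k} <+> {1..l}) p}"

definition position :: "nat \<Rightarrow> nat \<Rightarrow> nat + nat \<Rightarrow> nat" where
  "position k l z = (case z of Inl x \<Rightarrow> x | Inr y \<Rightarrow> k + (l + 1 - y))"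

definition noncrossing :: "nat \<Rightarrow> nat \<Rightarrow> (nat + nat) set set \<Rightarrow> bool" where
  "noncrossing k l p \<longleftrightarrow> \<not> (\<exists>a b c d. is_crossing (position k l) p a b c d)"


section \<open>Vectors and matrices of partitions\<close>

text \<open>Matrix indices below \<open>N ^ k\<close> stand for multi-indices of length \<open>k\<close> with entries
  in \<open>{0..<N}\<close> (instead of \<open>{1..N}\<close>), listed lexicographically, so that the leftmost entry is the
  most significant digit in base \<open>N\<close>. \<open>digit N k a x\<close> is the \<open>x\<close>-th entry, for \<open>x \<in> {1..k}\<close>.\<close>

definition digit :: "nat \<Rightarrow> nat \<Rightarrow> nat \<Rightarrow> nat \<Rightarrow> nat" where
  "digit N k a x = a div N ^ (k - x) mod N"

text \<open>The coordinate of \<open>xi N k p\<close> at a multi-index counts the number of summands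
  \<open>e\<^sub>i\<^sub>1 \<otimes> \<dots> \<otimes> e\<^sub>i\<^sub>k\<close> with that multi-index, which is 0 or 1.\<close>

definition xi :: "nat \<Rightarrow> nat \<Rightarrow> nat set set \<Rightarrow> complex mat" where
  "xi N k p = mat (N ^ k) 1 (\<lambda>(a, _).
     if \<forall>x\<in>{1..k}. \<forall>y\<in>{1..k}. same_block p x y \<longrightarrow> digit N k a x = digit N k a y
     then 1 else 0)"

definition label :: "nat \<Rightarrow> nat \<Rightarrow> nat \<Rightarrow> nat \<Rightarrow> nat \<Rightarrow> nat + nat \<Rightarrow> nat" where
  "label N k l a b z = (case z of Inl x \<Rightarrow> digit N k b x | Inr y \<Rightarrow> digit N l a y)"

definition T :: "nat \<Rightarrow> nat \<Rightarrow> nat \<Rightarrow> (nat + nat) set set \<Rightarrow> complex mat" where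
  "T N k l p = mat (N ^ l) (N ^ k) (\<lambda>(a, b).
     if \<forall>x \<in> {1..k} <+> {1..l}. \<forall>y \<in> {1..k} <+> {1..l}.
          same_block p x y \<longrightarrow> label N k l a b x = label N k l a b y
     then 1 else 0)"

lemma xi_eq_T: "xi N k p = T N 0 k ((`) Inr ` p)"
proof -
  have "same_block ((`) Inr ` p) (Inr x :: nat + nat) (Inr y) = same_block p x y" for x y
    by (auto simp: same_block_def)
  moreover have "{1..0::nat} <+> {1..k} = (Inr ` {1..k} :: (nat + nat) set)"
    by auto
  ultimately show ?thesis
    by (simp add: xi_def T_def label_def)
qed


section \<open>Tannaka--Krein duals\<close>

abbreviation mat_space :: "nat \<Rightarrow> nat \<Rightarrow> (complex, complex mat) module" where
  "mat_space nr nc \<equiv> module_mat TYPE(complex) nr nc"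

definition kron :: "complex mat \<Rightarrow> complex mat \<Rightarrow> complex mat" where
  "kron A B = mat (dim_row A * dim_row B) (dim_col A * dim_col B) (\<lambda>(i, j).
     A $$ (i div dim_row B, j div dim_col B) * B $$ (i mod dim_row B, j mod dim_col B))"

text \<open>The encoding of multi-indices turns the Kronecker product into concatenation.\<close>

lemma digit_kron_left:
  assumes "b < N ^ l" "x \<le> k"
  shows "digit N (k + l) (a * N ^ l + b) x = digit N k a x"
proof -
  have "N ^ (k + l - x) = N ^ l * N ^ (k - x)"
    using assms(2) by (simp add: algebra_simps flip: power_add)
  moreover have "(a * N ^ l + b) div N ^ l = a"
    using assms(1) div_mult_self3[of "N ^ l" a b] by (cases "N ^ l = 0") auto
  ultimately show ?thesis
    by (simp add: digit_def div_mult2_eq)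
qed

lemma digit_kron_right:
  assumes "b < N ^ l" "1 \<le> x" "x \<le> l"
  shows "digit N (k + l) (a * N ^ l + b) (k + x) = digit N l b x"
proof -
  have N: "N > 0"
    using assms by (cases "N = 0") (auto simp: power_0_left)
  have "N ^ l = N ^ (x - 1) * N * N ^ (l - x)"
    using assms(2,3) by (simp flip: power_add power_Suc2)
  then have "a * N ^ l + b = b + (a * N ^ (x - 1) * N) * N ^ (l - x)"
    by (simp add: algebra_simps)
  moreover have "N ^ (l - x) \<noteq> 0"
    using N by simp
  ultimately have "(a * N ^ l + b) div N ^ (l - x) = a * N ^ (x - 1) * N + b div N ^ (l - x)"
    by (metis div_mult_self1)
  then show ?thesis
    by (simp add: digit_def)
qed

text \<open>\<open>C k l\<close> is the space of morphisms from \<open>k\<close> to \<open>l\<close>, consisting of matrices with \<open>N ^ l\<close> rows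
  and \<open>N ^ k\<close> columns.\<close>

definition tk_dual :: "nat \<Rightarrow> (nat \<Rightarrow> nat \<Rightarrow> complex mat set) \<Rightarrow> bool" where
  "tk_dual N C \<longleftrightarrow>
     (\<forall>k l. VectorSpace.subspace class_ring (C k l) (mat_space (N ^ l) (N ^ k))) \<and>
     (\<forall>k l k' l'. \<forall>A\<in>C k l. \<forall>B\<in>C k' l'. kron A B \<in> C (k + k') (l + l')) \<and>
     (\<forall>k l n. \<forall>A\<in>C k l. \<forall>B\<in>C l n. B * A \<in> C k n) \<and>
     (\<forall>k l. \<forall>A\<in>C k l. mat_adjoint A \<in> C l k) \<and>
     1\<^sub>m N \<in> C 1 1 \<and>
     mat 1 (N ^ 2) (\<lambda>(_, b). if digit N 2 b 1 = digit N 2 b 2 then 1 else 0) \<in> C 2 0"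

definition hom_P :: "nat \<Rightarrow> nat \<Rightarrow> nat \<Rightarrow> complex mat set" where
  "hom_P N k l = LinearCombinations.module.span class_ring (mat_space (N ^ l) (N ^ k))
     {T N k l p | p. p \<in> two_row_partitions k l}"

definition hom_NC :: "nat \<Rightarrow> nat \<Rightarrow> nat \<Rightarrow> complex mat set" where
  "hom_NC N k l = LinearCombinations.module.span class_ring (mat_space (N ^ l) (N ^ k))
     {T N k l p | p. p \<in> two_row_partitions k l \<and> noncrossing k l p}"

text \<open>The smallest dual containing the family \<open>D\<close> and the vector \<open>\<xi>\<close>, as an intersection of duals.\<close>

definition tk_generated ::
    "nat \<Rightarrow> (nat \<Rightarrow> nat \<Rightarrow> complex mat set) \<Rightarrow> nat \<Rightarrow> complex mat \<Rightarrow> nat \<Rightarrow> nat \<Rightarrow> complex mat set" where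
  "tk_generated N D n \<xi> k l =
     \<Inter> {C k l | C. tk_dual N C \<and> (\<forall>k' l'. D k' l' \<subseteq> C k' l') \<and> \<xi> \<in> C 0 n}"

lemma mem_tk_generated:
  "A \<in> tk_generated N D n \<xi> k l \<longleftrightarrow>
     (\<forall>C. tk_dual N C \<and> (\<forall>k' l'. D k' l' \<subseteq> C k' l') \<and> \<xi> \<in> C 0 n \<longrightarrow> A \<in> C k l)"
  by (auto simp: tk_generated_def)

lemma tk_generated_least:
  assumes "tk_dual N C" "\<And>k l. D k l \<subseteq> C k l" "\<xi> \<in> C 0 n"
  shows "tk_generated N D n \<xi> k l \<subseteq> C k l"
  using assms unfolding tk_generated_def by blast

lemma tk_dual_full: "tk_dual N (\<lambda>k l. carrier_mat (N ^ l) (N ^ k))"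
proof -
  have "VectorSpace.subspace class_ring (carrier_mat r c) (mat_space r c)" for r c
  proof -
    interpret matrix_vs r c "TYPE(complex)" .
    show ?thesis
      by (auto simp: VectorSpace.subspace_def submodule_def matrix_vs_simps
          intro: vectorspace_axioms module_axioms)
  qed
  then show ?thesis
    by (auto simp: tk_dual_def kron_def mat_adjoint_def power_add)
qed

text \<open>The intersection is itself a dual containing \<open>D\<close> and \<open>\<xi>\<close>.\<close>

lemma tk_dual_tk_generated:
  assumes D: "\<And>k l. D k l \<subseteq> carrier_mat (N ^ l) (N ^ k)" and \<xi>: "\<xi> \<in> carrier_mat (N ^ n) 1"
  shows "tk_dual N (tk_generated N D n \<xi>)"
    and "D k l \<subseteq> tk_generated N D n \<xi> k l"
    and "\<xi> \<in> tk_generated N D n \<xi> 0 n"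
proof -
  have full: "tk_generated N D n \<xi> k l \<subseteq> carrier_mat (N ^ l) (N ^ k)" for k l
    using tk_generated_least[OF tk_dual_full] D \<xi> by auto
  have sub: "VectorSpace.subspace class_ring (tk_generated N D n \<xi> k l) (mat_space (N ^ l) (N ^ k))"
    for k l
  proof -
    interpret matrix_vs "N ^ l" "N ^ k" "TYPE(complex)" .
    have "submodule class_ring (tk_generated N D n \<xi> k l) (mat_space (N ^ l) (N ^ k))"
    proof (rule submodule.intro)
      show "Module.module class_ring (mat_space (N ^ l) (N ^ k))"
        by (rule module_axioms)
    next
      show "tk_generated N D n \<xi> k l \<subseteq> carrier (mat_space (N ^ l) (N ^ k))"
        using full by (simp add: matrix_vs_simps)
    next
      fix v w :: "complex mat" and c :: complex
      have *: "submodule class_ring (C k l) (mat_space (N ^ l) (N ^ k))" if "tk_dual N C" for C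
        using that by (auto simp: tk_dual_def VectorSpace.subspace_def)
      show "v \<oplus>\<^bsub>mat_space (N ^ l) (N ^ k)\<^esub> w \<in> tk_generated N D n \<xi> k l"
        if "v \<in> tk_generated N D n \<xi> k l" "w \<in> tk_generated N D n \<xi> k l"
        using that * unfolding mem_tk_generated by (blast intro: submodule.m_closed)
      show "\<zero>\<^bsub>mat_space (N ^ l) (N ^ k)\<^esub> \<in> tk_generated N D n \<xi> k l"
        using * unfolding mem_tk_generated by (blast intro: submodule.zero_closed)
      show "c \<odot>\<^bsub>mat_space (N ^ l) (N ^ k)\<^esub> v \<in> tk_generated N D n \<xi> k l"
        if "c \<in> carrier class_ring" "v \<in> tk_generated N D n \<xi> k l"
        using that * unfolding mem_tk_generated by (blast intro: submodule.smult_closed)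
    qed
    then show ?thesis
      by (simp add: VectorSpace.subspace_def vectorspace_axioms)
  qed
  show "tk_dual N (tk_generated N D n \<xi>)"
    unfolding tk_dual_def
  proof (intro conjI allI ballI)
    fix k l
    show "VectorSpace.subspace class_ring (tk_generated N D n \<xi> k l) (mat_space (N ^ l) (N ^ k))"
      by (rule sub)
  next
    fix k l n' A B
    assume "A \<in> tk_generated N D n \<xi> k l" "B \<in> tk_generated N D n \<xi> l n'"
    moreover have "B * A \<in> C k n'" if "tk_dual N C" "A \<in> C k l" "B \<in> C l n'" for C
      using that by (auto simp: tk_dual_def)
    ultimately show "B * A \<in> tk_generated N D n \<xi> k n'"
      unfolding mem_tk_generated by blast
  qed (unfold mem_tk_generated, simp_all add: tk_dual_def)
  show "D k l \<subseteq> tk_generated N D n \<xi> k l" "\<xi> \<in> tk_generated N D n \<xi> 0 n"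
    by (auto simp: tk_generated_def)
qed

end

(* All partitions p_i with the same crossings have the same crossing blocks (blocks that cross some other block):
   two points of such a block are separated by a crossing, or both are separated by a crossing from a common
   third point of the block. Hence xi is a product of one fixed crossing part, supported on the set S of points
   in crossings, and a combination v of vectors of non-crossing partitions of the complement of S.
   Pick a crossing a < b < c < d, rotate so that a is the first point, and pick j with <xi_(p_j), xi> nonzero.
   The non-crossing blocks of p_j do not separate a, b, c, d, so the following map is non-crossing: contract the
   points off S with the non-crossing blocks of p_j, sum over the points of S other than a, b, c, d, and keep these
   four. It sends xi to a nonzero multiple of the vector of the basic crossing, hence the flip is a morphism.
   Permuting the legs of vectors of interval partitions then gives all partitions.
   Conversely, the spaces of P are the invariants of the symmetric group S_N, so P is itself a dual. *)
theory Submission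
  imports Defs
begin

section \<open>Matrices as functions of pairs of words\<close>

text \<open>For small N the vectors of partitions are linearly dependent, so the coefficients of xi
  cannot be read off and no summand can be singled out. What survives is the pairing: a non-zero
  vector of a span is not orthogonal to all spanning vectors, and this produces p_j. The pairing is
  also the sum of all entries of the contracted vector with four legs. That vector lives on the
  words s t s t, and its entry there does not depend on s and t, because no crossing block reaches
  the part off S; so a non-zero sum suffices. The rotation removes an obstacle: an arc off S from a
  point before a to a point after d separates none of a, b, c, d on the circle, yet it would cut all
  four strands that carry them to the other row. Closing P under composition by stacking partitions
  would mean counting removed loops. Invariance under relabelling makes every closure property
  immediate; the price is to write each invariant as a combination of partition matrices.\<close>

definition words :: "nat \<Rightarrow> nat \<Rightarrow> nat list set" where
  "words N n = {w. set w \<subseteq> {..<N} \<and> length w = n}"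

definition word :: "nat \<Rightarrow> nat \<Rightarrow> nat \<Rightarrow> nat list" where
  "word N k a = map (digit N k a) [1..<Suc k]"

lemma length_word [simp]: "length (word N k a) = k"
  by (simp add: word_def)

lemma word_nth: "i < k \<Longrightarrow> word N k a ! i = digit N k a (Suc i)"
  by (simp add: word_def del: upt_Suc)

lemma finite_words [simp]: "finite (words N n)"
  unfolding words_def by (rule finite_lists_length_eq) simp

lemma words_lengthD: "w \<in> words N n \<Longrightarrow> length w = n"
  by (simp add: words_def)

lemma words_nthD: "w \<in> words N n \<Longrightarrow> i < n \<Longrightarrow> w ! i < N"
  by (force simp: words_def)

lemma word_append:
  assumes "b < N ^ l"
  shows "word N (k + l) (a * N ^ l + b) = word N k a @ word N l b"
proof (rule nth_equalityI)
  fix i assume "i < length (word N (k + l) (a * N ^ l + b))"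
  then have i: "i < k + l" by simp
  show "word N (k + l) (a * N ^ l + b) ! i = (word N k a @ word N l b) ! i"
  proof (cases "i < k")
    case True
    then show ?thesis
      using digit_kron_left[OF assms, of "Suc i" k a] by (simp add: nth_append word_nth)
  next
    case False
    then show ?thesis
      using digit_kron_right[OF assms, of "Suc i - k" k a] i by (simp add: nth_append word_nth Suc_diff_le)
  qed
qed simp

lemma word_surj: "w \<in> words N k \<Longrightarrow> \<exists>a<N ^ k. word N k a = w"
proof (induction k arbitrary: w)
  case 0
  then show ?case by (simp add: words_def word_def)
next
  case (Suc k)
  then obtain v x where w: "w = v @ [x]" and v: "v \<in> words N k" and x: "x < N"
    by (cases w rule: rev_cases) (auto simp: words_def)
  obtain a where a: "a < N ^ k" "word N k a = v"
    using Suc.IH[OF v] by blast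
  have "a * N ^ 1 + x < N ^ Suc k"
  proof -
    have "a * N + x < (a + 1) * N" using x by simp
    also have "\<dots> \<le> N ^ k * N" using a by (intro mult_right_mono) auto
    finally show ?thesis by (simp add: mult.commute)
  qed
  moreover have "word N 1 x = [x]"
    using x by (simp add: word_def digit_def)
  ultimately show ?case
    using word_append[of x N 1 k a] x a w by auto
qed

text \<open>Both sets are finite of size \<open>N ^ k\<close>, so surjectivity already gives
  injectivity.\<close>

lemma bij_betw_word: "bij_betw (word N k) {..<N ^ k} (words N k)"
proof -
  have sub: "words N k \<subseteq> word N k ` {..<N ^ k}"
    using word_surj by blast
  have card: "card (words N k) = N ^ k"
    by (simp add: words_def card_lists_length_eq)
  have card_image: "card (word N k ` {..<N ^ k}) = N ^ k"
    using card_mono[OF _ sub] card_image_le[of "{..<N ^ k}" "word N k"] card by simp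
  then have "inj_on (word N k) {..<N ^ k}"
    by (intro eq_card_imp_inj_on) auto
  moreover have "words N k = word N k ` {..<N ^ k}"
    using sub card card_image by (intro card_subset_eq) auto
  ultimately show ?thesis
    by (simp add: bij_betw_def)
qed

lemma word_in_words: "a < N ^ k \<Longrightarrow> word N k a \<in> words N k"
  using bij_betw_word[of N k] by (auto simp: bij_betw_def)

lemma words_take: "u \<in> words N (k + l) \<Longrightarrow> take k u \<in> words N k"
  by (auto simp: words_def dest: in_set_takeD)

lemma words_drop: "u \<in> words N (k + l) \<Longrightarrow> drop k u \<in> words N l"
  by (auto simp: words_def dest: in_set_dropD)

lemma words_0 [simp]: "words N 0 = {[]}"
  by (auto simp: words_def)

text \<open>The first argument of \<open>F\<close> is the word of the column (inputs), the second
  that of the row (outputs), so that \<open>F u v\<close> reads in the direction of hom(k,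
  l).\<close>

definition mat_of :: "nat \<Rightarrow> nat \<Rightarrow> nat \<Rightarrow> (nat list \<Rightarrow> nat list \<Rightarrow> complex) \<Rightarrow> complex mat" where
  "mat_of N k l F = mat (N ^ l) (N ^ k) (\<lambda>(a, b). F (word N k b) (word N l a))"

lemma mat_of_carrier [simp]: "mat_of N k l F \<in> carrier_mat (N ^ l) (N ^ k)"
  by (simp add: mat_of_def)

lemma mat_of_cong:
  assumes "\<And>u v. u \<in> words N k \<Longrightarrow> v \<in> words N l \<Longrightarrow> F u v = G u v"
  shows "mat_of N k l F = mat_of N k l G"
  by (rule eq_matI) (simp_all add: mat_of_def assms word_in_words)

lemma mat_of_kron:
  "kron (mat_of N k l F) (mat_of N k' l' G) =
   mat_of N (k + k') (l + l') (\<lambda>u v. F (take k u) (take l v) * G (drop k u) (drop l v))"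
proof -
  have *: "word N (k + l) a = word N k (a div N ^ l) @ word N l (a mod N ^ l)" "a div N ^ l < N ^ k"
    "a mod N ^ l < N ^ l"
    if "a < N ^ k * N ^ l" for k l a
  proof -
    have "N ^ l > 0" using that by (cases "N ^ l = 0") auto
    then show "word N (k + l) a = word N k (a div N ^ l) @ word N l (a mod N ^ l)"
      using word_append[of "a mod N ^ l" N l k "a div N ^ l"]
      by (metis div_mult_mod_eq mod_less_divisor)
    show "a div N ^ l < N ^ k"
      using that by (simp add: less_mult_imp_div_less)
    show "a mod N ^ l < N ^ l" using \<open>N ^ l > 0\<close> by simp
  qed
  show ?thesis
    by (rule eq_matI) (auto simp: kron_def mat_of_def power_add *)
qed

lemma mat_of_mult:
  "mat_of N l n G * mat_of N k l F = mat_of N k n (\<lambda>u w. \<Sum>v\<in>words N l. F u v * G v w)"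
proof (rule eq_matI)
  fix a b assume "a < dim_row (mat_of N k n (\<lambda>u w. \<Sum>v\<in>words N l. F u v * G v w))"
    "b < dim_col (mat_of N k n (\<lambda>u w. \<Sum>v\<in>words N l. F u v * G v w))"
  then have ab: "a < N ^ n" "b < N ^ k" by (simp_all add: mat_of_def)
  have "(mat_of N l n G * mat_of N k l F) $$ (a, b) =
      (\<Sum>i<N ^ l. F (word N k b) (word N l i) * G (word N l i) (word N n a))"
    using ab by (simp add: mat_of_def scalar_prod_def atLeast0LessThan mult.commute)
  also have "\<dots> = (\<Sum>v\<in>words N l. F (word N k b) v * G v (word N n a))"
    by (rule sum.reindex_bij_betw[OF bij_betw_word])
  finally show "(mat_of N l n G * mat_of N k l F) $$ (a, b) =
      mat_of N k n (\<lambda>u w. \<Sum>v\<in>words N l. F u v * G v w) $$ (a, b)"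
    using ab by (simp add: mat_of_def)
qed (simp_all add: mat_of_def)

lemma mat_of_adjoint: "mat_adjoint (mat_of N k l F) = mat_of N l k (\<lambda>u v. cnj (F v u))"
  by (rule eq_matI) (auto simp: mat_adjoint_def mat_of_def mat_of_rows_def col_def)

lemma mat_of_add: "mat_of N k l F + mat_of N k l G = mat_of N k l (\<lambda>u v. F u v + G u v)"
  by (rule eq_matI) (auto simp: mat_of_def)

lemma mat_of_smult: "c \<cdot>\<^sub>m mat_of N k l F = mat_of N k l (\<lambda>u v. c * F u v)"
  by (rule eq_matI) (auto simp: mat_of_def)

lemma mat_of_zero: "0\<^sub>m (N ^ l) (N ^ k) = mat_of N k l (\<lambda>u v. 0)"
  by (rule eq_matI) (auto simp: mat_of_def)

lemma finsum_mat_of: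
  assumes "finite I"
  shows "finsum (mat_space (N ^ l) (N ^ k)) (\<lambda>i. mat_of N k l (F i)) I =
    mat_of N k l (\<lambda>u v. \<Sum>i\<in>I. F i u v)"
proof -
  interpret matrix_vs "N ^ l" "N ^ k" "TYPE(complex)" .
  show ?thesis
    using assms
  proof (induction I)
    case (insert i I)
    then have "finsum V (\<lambda>i. mat_of N k l (F i)) (insert i I) =
        mat_of N k l (F i) + finsum V (\<lambda>i. mat_of N k l (F i)) I"
      by (subst finsum_insert) (auto simp: matrix_vs_simps)
    with insert show ?case
      by (simp add: mat_of_add)
  qed (simp add: mat_of_zero)
qed

lemma word_1: "a < N \<Longrightarrow> word N (Suc 0) a = [a]"
  by (simp add: word_def digit_def)

lemma one_mat_of: "1\<^sub>m N = mat_of N 1 1 (\<lambda>u v. of_bool (u = v))"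
  by (rule eq_matI) (auto simp: mat_of_def word_1)

lemma cap_mat_of:
  "mat 1 (N ^ 2) (\<lambda>(_, b). if digit N 2 b 1 = digit N 2 b 2 then 1 else 0) =
   mat_of N 2 0 (\<lambda>u v. of_bool (u ! 0 = u ! 1))"
  by (rule eq_matI) (auto simp: mat_of_def word_nth numeral_2_eq_2)

section \<open>Partitions as fibres of labellings\<close>

text \<open>Partitions of positions are encoded by labellings \<open>h\<close> whose fibres are the blocks. Upper points
  come first and lower points follow in reverse, so that the order of positions detects crossings.\<close>

definition agree :: "nat \<Rightarrow> (nat \<Rightarrow> 'b) \<Rightarrow> nat list \<Rightarrow> bool" where
  "agree n h w \<longleftrightarrow> (\<forall>x<n. \<forall>y<n. h x = h y \<longrightarrow> w ! x = w ! y)"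

lemma sum_only:
  assumes "finite A" "a \<in> A" "\<And>x. x \<in> A \<Longrightarrow> x \<noteq> a \<Longrightarrow> f x = 0"
  shows "sum f A = (f a :: 'b :: comm_monoid_add)"
  using assms sum.mono_neutral_right[of A "{a}" f] by simp

definition noncrossing_labels :: "nat \<Rightarrow> (nat \<Rightarrow> 'b) \<Rightarrow> bool" where
  "noncrossing_labels n h \<longleftrightarrow>
     (\<forall>a b c d. a < b \<longrightarrow> b < c \<longrightarrow> c < d \<longrightarrow> d < n \<longrightarrow> h a = h c \<longrightarrow> h b = h d \<longrightarrow> h a = h b)"

definition points :: "nat \<Rightarrow> nat \<Rightarrow> (nat + nat) set" where
  "points k l = {1..k} <+> {1..l}"

lemma position_less:
  assumes "z \<in> points k l"
  shows "position k l z - 1 < k + l" "position k l z \<ge> 1"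
  using assms by (auto simp: points_def position_def)

lemma ex_point:
  assumes "i < k + l"
  shows "\<exists>z\<in>points k l. position k l z - 1 = i"
proof (cases "i < k")
  case True
  then show ?thesis
    by (intro bexI[of _ "Inl (i + 1)"]) (auto simp: points_def position_def)
next
  case False
  with assms show ?thesis
    by (intro bexI[of _ "Inr (k + l - i)"]) (auto simp: points_def position_def)
qed

text \<open>The circular order runs along the upper row and back along the lower one, hence the
  reversal. The \<open>- 1\<close> turns positions, which start at 1, into list indices.\<close>

lemma label_eq_nth:
  assumes "z \<in> points k l"
  shows "label N k l a b z = (word N k b @ rev (word N l a)) ! (position k l z - 1)"
  using assms by (auto simp: points_def label_def position_def nth_append word_nth rev_nth
      Suc_diff_Suc Suc_diff_le)

lemma T_eq_agree:
  assumes "\<And>x y. x \<in> points k l \<Longrightarrow> y \<in> points k l \<Longrightarrow>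
    same_block p x y \<longleftrightarrow> h (position k l x - 1) = h (position k l y - 1)"
  shows "T N k l p = mat_of N k l (\<lambda>u v. of_bool (agree (k + l) h (u @ rev v)))"
proof -
  have "(\<forall>x\<in>points k l. \<forall>y\<in>points k l. same_block p x y \<longrightarrow> label N k l a b x = label N k l a b y)
      \<longleftrightarrow> agree (k + l) h (word N k b @ rev (word N l a))" (is "?L \<longleftrightarrow> ?R") for a b
  proof
    assume L: ?L
    show ?R
      unfolding agree_def
    proof (intro allI impI)
      fix i j assume "i < k + l" "j < k + l" and h: "h i = h j"
      then obtain x y where xy: "x \<in> points k l" "y \<in> points k l"
        "position k l x - 1 = i" "position k l y - 1 = j"
        using ex_point by meson
      with L h assms[of x y] have "label N k l a b x = label N k l a b y" by auto
      then show "(word N k b @ rev (word N l a)) ! i = (word N k b @ rev (word N l a)) ! j"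
        using xy label_eq_nth by simp
    qed
  next
    assume ?R
    then show ?L
      using assms position_less(1) by (fastforce simp: agree_def label_eq_nth)
  qed
  then show ?thesis
    unfolding T_def mat_of_def points_def[symmetric] by (simp add: of_bool_def)
qed

lemma same_block_sym: "same_block p x y \<Longrightarrow> same_block p y x"
  by (auto simp: same_block_def)

lemma same_block_trans:
  assumes "partition_on A p" "same_block p x y" "same_block p y z"
  shows "same_block p x z"
proof -
  obtain B B' where *: "B \<in> p" "x \<in> B" "y \<in> B" "B' \<in> p" "y \<in> B'" "z \<in> B'"
    using assms(2,3) by (auto simp: same_block_def)
  then have "B = B'"
    using partition_onD2[OF assms(1)] by (auto dest: disjointD)
  with * show ?thesis
    by (auto simp: same_block_def)
qed

lemma same_block_refl: "partition_on A p \<Longrightarrow> x \<in> A \<Longrightarrow> same_block p x x"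
  by (auto simp: same_block_def partition_on_def)

lemma same_block_in:
  "partition_on A p \<Longrightarrow> same_block p x y \<Longrightarrow> x \<in> A \<and> y \<in> A"
  by (auto simp: same_block_def partition_on_def)

lemma T_labels:
  assumes "partition_on (points k l) p"
  obtains h :: "nat \<Rightarrow> nat" where
    "T N k l p = mat_of N k l (\<lambda>u v. of_bool (agree (k + l) h (u @ rev v)))"
proof -
  define pt where "pt i = (SOME z. z \<in> points k l \<and> position k l z - 1 = i)" for i
  have pt: "pt (position k l z - 1) = z" if "z \<in> points k l" for z
  proof -
    have "pt (position k l z - 1) \<in> points k l \<and>
        position k l (pt (position k l z - 1)) - 1 = position k l z - 1"
      unfolding pt_def by (rule someI[of _ z]) (use that in simp)
    with that show ?thesis
      by (auto simp: points_def position_def split: sum.splits)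
  qed
  \<comment> \<open>The label is the least position in the block. Labels that are natural numbers
    can be sorted later.\<close>
  define h where "h i = (LEAST j. j < k + l \<and> same_block p (pt i) (pt j))" for i
  note eq = same_block_sym same_block_trans[OF assms] same_block_refl[OF assms]
  have "same_block p x y \<longleftrightarrow> h (position k l x - 1) = h (position k l y - 1)"
    if xy: "x \<in> points k l" "y \<in> points k l" for x y
  proof
    assume "same_block p x y"
    then have "same_block p x = same_block p y"
      by (intro ext iffI) (metis eq(1,2))+
    then show "h (position k l x - 1) = h (position k l y - 1)"
      by (simp only: h_def pt[OF xy(1)] pt[OF xy(2)])
  next
    assume h: "h (position k l x - 1) = h (position k l y - 1)"
    have "same_block p z (pt (h (position k l z - 1)))" if "z \<in> points k l" for z
    proof -
      have "\<exists>j. j < k + l \<and> same_block p z (pt j)"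
        using position_less(1)[OF that] eq(3)[OF that] pt[OF that] by metis
      from LeastI_ex[OF this] show ?thesis by (simp only: h_def pt[OF that])
    qed
    from this[OF xy(1)] this[OF xy(2)] show "same_block p x y"
      unfolding h by (metis eq(1,2))
  qed
  then show thesis
    by (rule that[OF T_eq_agree])
qed

text \<open>The way back from \<open>T_labels\<close>: labels of any type define a partition of the
  two rows.\<close>

definition fibres :: "nat \<Rightarrow> nat \<Rightarrow> (nat \<Rightarrow> 'b) \<Rightarrow> (nat + nat) set set" where
  "fibres k l h = (\<lambda>x. {y \<in> points k l. h (position k l y - 1) = h (position k l x - 1)}) ` points k l"

lemma same_block_fibres:
  "same_block (fibres k l h) x y \<longleftrightarrow>
   x \<in> points k l \<and> y \<in> points k l \<and> h (position k l x - 1) = h (position k l y - 1)"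
  by (auto simp: same_block_def fibres_def)

lemma partition_fibres: "fibres k l h \<in> two_row_partitions k l"
  unfolding two_row_partitions_def points_def[symmetric]
  by (auto simp: fibres_def partition_on_def disjoint_def)

lemma T_fibres: "T N k l (fibres k l h) = mat_of N k l (\<lambda>u v. of_bool (agree (k + l) h (u @ rev v)))"
  by (rule T_eq_agree) (simp add: same_block_fibres)

lemma noncrossing_fibres:
  assumes "noncrossing_labels (k + l) h"
  shows "noncrossing k l (fibres k l h)"
  unfolding noncrossing_def
proof (intro notI; elim exE)
  fix a b c d assume "is_crossing (position k l) (fibres k l h) a b c d"
  then have r: "position k l a < position k l b" "position k l b < position k l c"
      "position k l c < position k l d"
    and s: "same_block (fibres k l h) a c" "same_block (fibres k l h) b d"
      "\<not> same_block (fibres k l h) a b"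
    by (auto simp: is_crossing_def)
  then have z: "a \<in> points k l" "b \<in> points k l" "c \<in> points k l" "d \<in> points k l"
    by (auto simp: same_block_fibres)
  then have "position k l a - 1 < position k l b - 1" "position k l b - 1 < position k l c - 1"
    "position k l c - 1 < position k l d - 1" "position k l d - 1 < k + l"
    using r position_less[OF z(1)] position_less[OF z(4)] by linarith+
  moreover have "h (position k l a - 1) = h (position k l c - 1)"
    "h (position k l b - 1) = h (position k l d - 1)" "h (position k l a - 1) \<noteq> h (position k l b - 1)"
    using s z by (simp_all add: same_block_fibres)
  ultimately show False
    using assms unfolding noncrossing_labels_def by metis
qed

lemma agree_cong:
  "(\<And>x y. x < n \<Longrightarrow> y < n \<Longrightarrow> h x = h y \<longleftrightarrow> h' x = h' y) \<Longrightarrow> agree n h w = agree n h' w"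
  by (auto simp: agree_def)

lemma agree_rev:
  assumes "length w = n"
  shows "agree n h (rev w) = agree n (\<lambda>i. h (n - 1 - i)) w"
proof -
  have "agree n h (rev w) \<longleftrightarrow> (\<forall>x\<in>{..<n}. \<forall>y\<in>{..<n}. h x = h y \<longrightarrow> rev w ! x = rev w ! y)"
    by (auto simp: agree_def)
  also have "{..<n} = (\<lambda>i. n - 1 - i) ` {..<n}"
  proof
    show "{..<n} \<subseteq> (\<lambda>i. n - 1 - i) ` {..<n}"
      proof
      fix x assume "x \<in> {..<n}"
      then show "x \<in> (\<lambda>i. n - 1 - i) ` {..<n}"
        by (intro image_eqI[of _ _ "n - 1 - x"]) auto
    qed
  qed auto
  finally show ?thesis
    using assms by (auto simp: agree_def rev_nth)
qed

section \<open>Tannaka--Krein duals containing the non-crossing partitions\<close>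

lemma tk_dual_smult:
  assumes "tk_dual N C" "A \<in> C k l"
  shows "c \<cdot>\<^sub>m A \<in> C k l"
proof -
  have "submodule class_ring (C k l) (mat_space (N ^ l) (N ^ k))"
    using assms by (auto simp: tk_dual_def VectorSpace.subspace_def)
  from submodule.smult_closed[OF this, of c A] assms(2) show ?thesis
    by (simp add: matrix_vs_simps)
qed

text \<open>\<open>C\<close> stands for an arbitrary member of the family whose intersection is
  \<open>tk_generated\<close>; the membership of xi is added where it is used.\<close>

locale dual_over_NC =
  fixes N :: nat and C :: "nat \<Rightarrow> nat \<Rightarrow> complex mat set"
  assumes N: "N \<ge> 1" and dual: "tk_dual N C" and NC: "\<And>k l. hom_NC N k l \<subseteq> C k l"
begin

definition in_hom :: "nat \<Rightarrow> nat \<Rightarrow> (nat list \<Rightarrow> nat list \<Rightarrow> complex) \<Rightarrow> bool" where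
  "in_hom k l F \<longleftrightarrow> mat_of N k l F \<in> C k l"

lemma hom_cong:
  assumes "in_hom k l F" "\<And>u v. u \<in> words N k \<Longrightarrow> v \<in> words N l \<Longrightarrow> F u v = G u v"
  shows "in_hom k l G"
  using assms(1) mat_of_cong[of N k l F G, OF assms(2)] by (simp add: in_hom_def)

lemma hom_kron:
  assumes "in_hom k l F" "in_hom k' l' G"
  shows "in_hom (k + k') (l + l') (\<lambda>u v. F (take k u) (take l v) * G (drop k u) (drop l v))"
proof -
  have "kron (mat_of N k l F) (mat_of N k' l' G) \<in> C (k + k') (l + l')"
    using dual assms by (simp add: tk_dual_def in_hom_def)
  then show ?thesis
    by (simp only: in_hom_def mat_of_kron)
qed

lemma hom_comp:
  assumes "in_hom k l F" "in_hom l n G"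
  shows "in_hom k n (\<lambda>u w. \<Sum>v\<in>words N l. F u v * G v w)"
proof -
  have "\<And>A B. A \<in> C k l \<Longrightarrow> B \<in> C l n \<Longrightarrow> B * A \<in> C k n"
    using dual by (simp add: tk_dual_def)
  then have "mat_of N l n G * mat_of N k l F \<in> C k n"
    using assms by (simp add: in_hom_def)
  then show ?thesis
    by (simp only: in_hom_def mat_of_mult)
qed

lemma hom_adjoint: "in_hom k l F \<Longrightarrow> in_hom l k (\<lambda>u v. cnj (F v u))"
  using dual by (simp add: in_hom_def tk_dual_def flip: mat_of_adjoint)

lemma hom_scale: "in_hom k l F \<Longrightarrow> in_hom k l (\<lambda>u v. c * F u v)"
  using tk_dual_smult[OF dual, of _ k l c] by (auto simp: in_hom_def simp flip: mat_of_smult)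

lemma hom_noncrossing:
  assumes "noncrossing_labels (k + l) h"
  shows "in_hom k l (\<lambda>u v. of_bool (agree (k + l) h (u @ rev v)))"
proof -
  interpret matrix_vs "N ^ l" "N ^ k" "TYPE(complex)" .
  have "T N k l (fibres k l h) \<in> hom_NC N k l"
    unfolding hom_NC_def
    using noncrossing_fibres[OF assms] partition_fibres
    by (intro subsetD[OF in_own_span]) (auto simp: T_def)
  then show ?thesis
    using NC by (auto simp: in_hom_def T_fibres)
qed

lemma hom_id: "in_hom l l (\<lambda>u v. of_bool (u = v))"
proof (induction l)
  case 0
  \<comment> \<open>The scalar 1 is not among the axioms of a dual; here it comes from the empty
    partition, which is non-crossing.\<close>
  have "in_hom 0 0 (\<lambda>u v. of_bool (agree 0 id (u @ rev v)))"
    using hom_noncrossing[of 0 0 id] by (simp add: noncrossing_labels_def)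
  then show ?case
    by (rule hom_cong) (simp add: agree_def)
next
  case (Suc l)
  have "in_hom 1 1 (\<lambda>u v. of_bool (u = v))"
    using dual by (simp only: in_hom_def tk_dual_def one_mat_of)
  from hom_kron[OF Suc this]
  have "in_hom (Suc l) (Suc l) (\<lambda>u v. of_bool (take l u = take l v) * of_bool (drop l u = drop l v))"
    by simp
  then show ?case
  proof (rule hom_cong)
    fix u v :: "nat list"
    have "u = v \<longleftrightarrow> take l u = take l v \<and> drop l u = drop l v"
      by (metis append_take_drop_id)
    then show "of_bool (take l u = take l v) * of_bool (drop l u = drop l v) = (of_bool (u = v) :: complex)"
      by simp
  qed
qed

section \<open>Bending and rotating legs\<close>

lemma hom_cap: "in_hom 2 0 (\<lambda>u v. of_bool (u ! 0 = u ! 1))"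
  using dual by (simp only: in_hom_def tk_dual_def cap_mat_of)

text \<open>Frobenius reciprocity: add an identity strand on the right and close it with the last
  output by the cap.\<close>

lemma hom_bend:
  assumes "in_hom k (Suc l) F"
  shows "in_hom (Suc k) l (\<lambda>u v. F (butlast u) (v @ [last u]))"
proof -
  have F: "in_hom (Suc k) (l + 2)
      (\<lambda>u v. F (take k u) (take (Suc l) v) * of_bool (drop k u = drop (Suc l) v))"
    using hom_kron[OF assms hom_id[of 1]] by simp
  have G: "in_hom (l + 2) l (\<lambda>u v. of_bool (take l u = take l v) * of_bool (drop l u ! 0 = drop l u ! 1))"
    using hom_kron[OF hom_id[of l] hom_cap] by simp
  show ?thesis
  proof (rule hom_cong[OF hom_comp[OF F G]])
    fix u v assume u: "u \<in> words N (Suc k)" and v: "v \<in> words N l"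
    from u obtain u' x where ux: "u = u' @ [x]" "length u' = k" "x < N"
      by (cases u rule: rev_cases) (auto simp: words_def)
    \<comment> \<open>The identity strand forces the last letter of the intermediate word to be
      \<open>x\<close>, and the cap copies it to the letter before.\<close>
    have "(\<Sum>w\<in>words N (l + 2). F (take k u) (take (Suc l) w) * of_bool (drop k u = drop (Suc l) w) *
      (of_bool (take l w = take l v) * of_bool (drop l w ! 0 = drop l w ! 1))) =
      F (take k u) (take (Suc l) (v @ [x, x])) * of_bool (drop k u = drop (Suc l) (v @ [x, x])) *
      (of_bool (take l (v @ [x, x]) = take l v) * of_bool (drop l (v @ [x, x]) ! 0 = drop l (v @ [x, x]) ! 1))"
    proof (rule sum_only)
      show "v @ [x, x] \<in> words N (l + 2)"
        using v ux by (auto simp: words_def)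
      fix w assume w: "w \<in> words N (l + 2)" "w \<noteq> v @ [x, x]"
      then obtain w' y z where wyz: "w = w' @ [y, z]" "length w' = l"
        by (cases w rule: rev_cases; cases "butlast w" rule: rev_cases) (auto simp: words_def)
      show "F (take k u) (take (Suc l) w) * of_bool (drop k u = drop (Suc l) w) *
         (of_bool (take l w = take l v) * of_bool (drop l w ! 0 = drop l w ! 1)) = 0"
        using w(2) v words_lengthD[OF v] by (auto simp: wyz ux)
    qed simp
    also have "\<dots> = F (butlast u) (v @ [last u])"
      using words_lengthD[OF v] by (simp add: ux)
    finally show "(\<Sum>w\<in>words N (l + 2). F (take k u) (take (Suc l) w) * of_bool (drop k u = drop (Suc l) w) *
      (of_bool (take l w = take l v) * of_bool (drop l w ! 0 = drop l w ! 1))) = F (butlast u) (v @ [last u])" .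
  qed
qed

text \<open>Each bend turns the last output into the last input, so the inputs reappear behind the
  outputs in reverse order.\<close>

lemma hom_bend_all: "in_hom 0 (k + l) (\<lambda>_. F) \<Longrightarrow> in_hom k l (\<lambda>u v. F (v @ rev u))"
proof (induction k arbitrary: l)
  case 0
  then show ?case by (auto elim: hom_cong)
next
  case (Suc k)
  then have "in_hom k (Suc l) (\<lambda>u v. F (v @ rev u))"
    by simp
  from hom_bend[OF this] show ?case
  proof (rule hom_cong)
    fix u v assume "u \<in> words N (Suc k)"
    then have "u \<noteq> []" by (auto simp: words_def)
    then show "F ((v @ [last u]) @ rev (butlast u)) = F (v @ rev u)"
      by (cases u rule: rev_cases) auto
  qed
qed

text \<open>Bend the last leg to an input and feed it with the right half of a cup. The left half
  then stands in front of the remaining legs, so the leg has travelled from the end to the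
  beginning.\<close>

lemma hom_rotate1:
  assumes "in_hom 0 k (\<lambda>_. F)"
  shows "in_hom 0 k (\<lambda>_ v. F (rotate1 v))"
proof (cases k)
  case 0
  with assms show ?thesis by (auto elim: hom_cong)
next
  case (Suc l)
  note F = hom_kron[OF hom_id[of 1] hom_bend[OF assms[unfolded Suc]]]
  have cup: "in_hom 0 (1 + Suc 0) (\<lambda>u v. cnj (of_bool (v ! 0 = v ! 1)))"
    using hom_adjoint[OF hom_cap] by (simp add: numeral_2_eq_2)
  from hom_comp[OF cup F] have "in_hom 0 k (\<lambda>u v. \<Sum>w\<in>words N (Suc (Suc 0)).
      cnj (of_bool (w ! 0 = w ! 1)) * (of_bool (take 1 w = take 1 v) * F (drop 1 v @ [last (drop 1 w)])))"
    by (simp add: Suc)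
  then show ?thesis
  proof (rule hom_cong)
    fix u v assume v: "v \<in> words N k"
    then obtain x v' where xv: "v = x # v'" "x < N"
      by (cases v) (auto simp: words_def Suc)
    have "(\<Sum>w\<in>words N (Suc (Suc 0)). cnj (of_bool (w ! 0 = w ! 1)) *
        (of_bool (take 1 w = take 1 v) * F (drop 1 v @ [last (drop 1 w)]))) =
      cnj (of_bool ([x, x] ! 0 = [x, x] ! 1)) * (of_bool (take 1 [x, x] = take 1 v) * F (drop 1 v @ [last (drop 1 [x, x])]))"
    proof (rule sum_only)
      fix w assume w: "w \<in> words N (Suc (Suc 0))" "w \<noteq> [x, x]"
      then obtain y z where "w = [y, z]"
        by (auto simp: words_def length_Suc_conv)
      with w show "cnj (of_bool (w ! 0 = w ! 1)) * (of_bool (take 1 w = take 1 v) * F (drop 1 v @ [last (drop 1 w)])) = 0"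
        by (auto simp: xv)
    next
      show "[x, x] \<in> words N (Suc (Suc 0))"
        using xv by (simp add: words_def)
    qed simp
    then show "(\<Sum>w\<in>words N (Suc (Suc 0)). cnj (of_bool (w ! 0 = w ! 1)) *
        (of_bool (take 1 w = take 1 v) * F (drop 1 v @ [last (drop 1 w)]))) = F (rotate1 v)"
      by (simp add: xv)
  qed
qed

lemma hom_rotate: "in_hom 0 k (\<lambda>_. F) \<Longrightarrow> in_hom 0 k (\<lambda>_ v. F (rotate n v))"
proof (induction n)
  case (Suc n)
  from hom_rotate1[OF Suc.IH[OF Suc.prems]] show ?case
    by (simp add: rotate1_rotate_swap)
qed simp

end

section \<open>The crossing generates all partitions\<close>

definition crossing_word :: "nat list \<Rightarrow> bool" where
  "crossing_word w \<longleftrightarrow> w ! 0 = w ! 2 \<and> w ! 1 = w ! 3"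

locale dual_with_crossing = dual_over_NC +
  assumes crossing: "in_hom 0 4 (\<lambda>_ w. of_bool (crossing_word w))"
begin

text \<open>Bending two legs of the crossing gives the flip: for \<open>u = [a, b]\<close> and
  \<open>v = [c, d]\<close> the word \<open>v @ rev u\<close> is \<open>[c, d, b, a]\<close>, so the
  condition reads \<open>c = b\<close> and \<open>d = a\<close>.\<close>

lemma hom_swap: "in_hom 2 2 (\<lambda>u v. of_bool (v = rev u))"
proof -
  have "in_hom 0 (2 + 2) (\<lambda>_ w. of_bool (crossing_word w))"
    using crossing by simp
  from hom_bend_all[OF this] show ?thesis
  proof (rule hom_cong)
    fix u v assume "u \<in> words N 2" "v \<in> words N 2"
    then obtain a b c d where "u = [a, b]" "v = [c, d]"
      by (auto simp: words_def length_Suc_conv numeral_2_eq_2)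
    then show "of_bool (crossing_word (v @ rev u)) = (of_bool (v = rev u) :: complex)"
      by (auto simp: crossing_word_def)
  qed
qed

text \<open>The flip is applied between identities on \<open>i\<close> and \<open>j\<close> legs;
  \<open>?v\<close> below is the only intermediate word that contributes.\<close>

lemma hom_swap_at:
  assumes "in_hom 0 (i + (2 + j)) (\<lambda>_. F)"
  shows "in_hom 0 (i + (2 + j))
    (\<lambda>_ w. F (take i w @ rev (take 2 (drop i w)) @ drop 2 (drop i w)))"
proof -
  have *: "in_hom (i + (2 + j)) (i + (2 + j)) (\<lambda>u v. of_bool (take i u = take i v) *
      (of_bool (take 2 (drop i v) = rev (take 2 (drop i u))) *
       of_bool (drop 2 (drop i u) = drop 2 (drop i v))))"
    using hom_kron[OF hom_id[of i] hom_kron[OF hom_swap hom_id[of j]]] by simp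
  show ?thesis
  proof (rule hom_cong[OF hom_comp[OF assms *]])
    fix u w assume w: "w \<in> words N (i + (2 + j))"
    let ?v = "take i w @ rev (take 2 (drop i w)) @ drop 2 (drop i w)"
    have eq: "take i v = take i w \<and> take 2 (drop i w) = rev (take 2 (drop i v)) \<and>
        drop 2 (drop i v) = drop 2 (drop i w) \<longleftrightarrow> v = ?v" if "v \<in> words N (i + (2 + j))" for v
    proof
      assume "take i v = take i w \<and> take 2 (drop i w) = rev (take 2 (drop i v)) \<and>
        drop 2 (drop i v) = drop 2 (drop i w)"
      moreover have "v = take i v @ take 2 (drop i v) @ drop 2 (drop i v)"
        by (simp only: append_take_drop_id)
      ultimately show "v = ?v"
        by (metis rev_rev_ident)
    next
      assume v: "v = ?v"
      have "length w = i + (2 + j)" using w by (rule words_lengthD)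
      then have "take i v = take i w" "drop i v = rev (take 2 (drop i w)) @ drop 2 (drop i w)"
        by (subst v, simp)+
      then show "take i v = take i w \<and> take 2 (drop i w) = rev (take 2 (drop i v)) \<and>
        drop 2 (drop i v) = drop 2 (drop i w)"
        using \<open>length w = i + (2 + j)\<close> by simp
    qed
    have v: "?v \<in> words N (i + (2 + j))"
      using w by (auto simp: words_def min_def dest!: in_set_takeD in_set_dropD)
    have "(\<Sum>v\<in>words N (i + (2 + j)). F v * (of_bool (take i v = take i w) *
      (of_bool (take 2 (drop i w) = rev (take 2 (drop i v))) *
       of_bool (drop 2 (drop i v) = drop 2 (drop i w))))) =
      (\<Sum>v\<in>words N (i + (2 + j)). F v * of_bool (v = ?v))"
      using eq by (intro sum.cong refl) (auto simp flip: of_bool_conj)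
    also have "\<dots> = F ?v"
      by (subst sum_only[OF _ v]) auto
    finally show "(\<Sum>v\<in>words N (i + (2 + j)). F v * (of_bool (take i v = take i w) *
      (of_bool (take 2 (drop i w) = rev (take 2 (drop i v))) *
       of_bool (drop 2 (drop i v) = drop 2 (drop i w))))) = F ?v" .
  qed
qed

text \<open>The labels form a list so that permuting legs means permuting the list; sorted lists
  give the interval partitions.\<close>

definition generated :: "nat list \<Rightarrow> bool" where
  "generated hs \<longleftrightarrow> in_hom 0 (length hs) (\<lambda>_ w. of_bool (agree (length hs) ((!) hs) w))"

lemma generated_swap:
  assumes "generated (xs @ a # b # ys)"
  shows "generated (xs @ b # a # ys)"
proof -
  let ?i = "length xs" and ?j = "length ys" and ?hs = "xs @ a # b # ys"
  let ?n = "length xs + (2 + length ys)"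
  \<comment> \<open>\<open>t\<close> exchanges the two neighbouring positions. It permutes all
    positions, so the quantifiers in \<open>agree\<close> may run over its values.\<close>
  define t where "t x = (if x = ?i then ?i + 1 else if x = ?i + 1 then ?i else x)" for x
  have "in_hom 0 ?n (\<lambda>_ w. of_bool (agree ?n ((!) ?hs) w))"
    using assms by (simp add: generated_def)
  from hom_swap_at[OF this] have "in_hom 0 ?n (\<lambda>_ w. of_bool (agree ?n ((!) (xs @ b # a # ys)) w))"
  proof (rule hom_cong)
    fix u w assume "w \<in> words N ?n"
    then have len: "length w = ?n" by (rule words_lengthD)
    define w1 w2 where "w1 = take ?i w" and "w2 = drop 2 (drop ?i w)"
    have "\<exists>c d. x = [c, d]" if "length x = 2" for x :: "nat list"
      using that by (auto simp: length_Suc_conv numeral_2_eq_2)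
    from this[of "take 2 (drop ?i w)"] obtain c d where cd: "take 2 (drop ?i w) = [c, d]"
      using len by auto
    have w: "w = w1 @ [c, d] @ w2"
      by (simp only: w1_def w2_def cd[symmetric] append_take_drop_id)
    have w1: "length w1 = ?i"
      using len by (simp add: w1_def)
    have nth_w: "(w1 @ [d, c] @ w2) ! x = w ! t x" for x
      by (auto simp: w nth_append w1 t_def nth_Cons' simp flip: w1)
    have nth_hs: "?hs ! x = (xs @ b # a # ys) ! t x" for x
      by (auto simp: nth_append t_def nth_Cons')
    have t: "t ` {..<?n} = {..<?n}"
    proof
      show "{..<?n} \<subseteq> t ` {..<?n}"
      proof
        fix x assume "x \<in> {..<?n}"
        then show "x \<in> t ` {..<?n}"
          by (intro image_eqI[of _ _ "t x"]) (auto simp: t_def)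
      qed
    qed (auto simp: t_def)
    have "agree ?n ((!) ?hs) (w1 @ [d, c] @ w2) \<longleftrightarrow>
      (\<forall>x\<in>t ` {..<?n}. \<forall>y\<in>t ` {..<?n}. (xs @ b # a # ys) ! x = (xs @ b # a # ys) ! y \<longrightarrow> w ! x = w ! y)"
      unfolding agree_def nth_w nth_hs by auto
    also have "\<dots> \<longleftrightarrow> agree ?n ((!) (xs @ b # a # ys)) w"
      unfolding t by (auto simp: agree_def)
    finally show "of_bool (agree ?n ((!) ?hs) (take ?i w @ rev (take 2 (drop ?i w)) @ drop 2 (drop ?i w))) =
      (of_bool (agree ?n ((!) (xs @ b # a # ys)) w) :: complex)"
      by (simp add: cd w1_def w2_def)
  qed
  then show ?thesis
    by (simp add: generated_def)
qed

lemma generated_move: "generated (xs @ ys @ a # zs) \<Longrightarrow> generated (xs @ a # ys @ zs)"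
proof (induction ys arbitrary: xs)
  case (Cons b ys)
  from Cons.IH[of "xs @ [b]"] Cons.prems have "generated (xs @ b # a # ys @ zs)"
    by simp
  from generated_swap[OF this] show ?case by simp
qed simp

text \<open>\<open>insort\<close> puts \<open>a\<close> behind the leading smaller entries of
  \<open>ys\<close>; moving it back to the front undoes this.\<close>

lemma generated_insort: "generated (xs @ insort a ys) \<Longrightarrow> generated (xs @ a # ys)"
proof -
  have "insort a ys = takeWhile (\<lambda>x. \<not> a \<le> x) ys @ a # dropWhile (\<lambda>x. \<not> a \<le> x) ys"
    by (induction ys) auto
  then show "generated (xs @ insort a ys) \<Longrightarrow> generated (xs @ a # ys)"
    using generated_move[of xs "takeWhile (\<lambda>x. \<not> a \<le> x) ys" a "dropWhile (\<lambda>x. \<not> a \<le> x) ys"] by simp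
qed

text \<open>Insertion sort read backwards: each insertion is undone by exchanges of neighbours. The
  prefix \<open>xs\<close> collects the labels already in their final place.\<close>

lemma generated_sort: "generated (xs @ sort ys) \<Longrightarrow> generated (xs @ ys)"
proof (induction ys arbitrary: xs)
  case (Cons a ys)
  from Cons.prems have "generated (xs @ insort a (sort ys))"
    by simp
  from generated_insort[OF this] have "generated ((xs @ [a]) @ sort ys)"
    by simp
  from Cons.IH[OF this] show ?case by simp
qed simp

text \<open>In a sorted list equal labels fill an interval, which nothing can cross.
  \<open>h\<close> reads the list from right to left because lower points are counted in that
  direction.\<close>

lemma generated_sorted:
  assumes "sorted hs"
  shows "generated hs"
proof -
  let ?n = "length hs"
  define h where "h i = hs ! (?n - 1 - i)" for i
  have "noncrossing_labels (0 + ?n) h"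
    unfolding noncrossing_labels_def
  proof (intro allI impI)
    fix a b c d assume *: "a < b" "b < c" "c < d" "d < 0 + ?n" and "h a = h c"
    from * have "h c \<le> h b"
      unfolding h_def by (intro sorted_nth_mono[OF assms]) auto
    moreover from * have "h b \<le> h a"
      unfolding h_def by (intro sorted_nth_mono[OF assms]) auto
    moreover note \<open>h a = h c\<close>
    ultimately show "h a = h b" by simp
  qed
  from hom_noncrossing[OF this] show ?thesis
    unfolding generated_def
  proof (rule hom_cong)
    fix u v assume "u \<in> words N 0" "v \<in> words N ?n"
    then have len: "length v = ?n" "u = []"
      by (auto dest: words_lengthD)
    have "agree ?n h (rev v) = agree ?n (\<lambda>i. h (?n - 1 - i)) v"
      by (rule agree_rev[OF len(1)])
    also have "\<dots> = agree ?n ((!) hs) v"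
      by (rule agree_cong) (simp add: h_def)
    finally show "of_bool (agree (0 + ?n) h (u @ rev v)) = (of_bool (agree ?n ((!) hs) v) :: complex)"
      by (simp add: len)
  qed
qed

text \<open>Sorting the labels reduces to interval partitions, and bending puts \<open>k\<close> of
  the legs into the upper row.\<close>

lemma hom_labels:
  fixes h :: "nat \<Rightarrow> nat"
  shows "in_hom k l (\<lambda>u v. of_bool (agree (k + l) h (u @ rev v)))"
proof -
  let ?n = "k + l"
  define hs where "hs = map (\<lambda>i. h (?n - 1 - i)) [0..<?n]"
  have "generated hs"
    using generated_sort[of "[]" hs] generated_sorted[of "sort hs"] by simp
  then have "in_hom 0 ?n (\<lambda>_ w. of_bool (agree ?n ((!) hs) w))"
    by (simp add: generated_def hs_def)
  from hom_bend_all[OF this] show ?thesis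
  proof (rule hom_cong)
    fix u v assume uv: "u \<in> words N k" "v \<in> words N l"
    have "agree ?n ((!) hs) (v @ rev u) = agree ?n (\<lambda>i. h (?n - 1 - i)) (v @ rev u)"
      by (rule agree_cong) (simp add: hs_def)
    also have "\<dots> = agree ?n h (rev (v @ rev u))"
      by (subst agree_rev) (simp_all add: words_lengthD[OF uv(1)] words_lengthD[OF uv(2)])
    finally show "of_bool (agree ?n ((!) hs) (v @ rev u)) = (of_bool (agree ?n h (u @ rev v)) :: complex)"
      by simp
  qed
qed

lemma hom_P_subset: "hom_P N k l \<subseteq> C k l"
proof -
  interpret matrix_vs "N ^ l" "N ^ k" "TYPE(complex)" .
  have "T N k l p \<in> C k l" if "p \<in> two_row_partitions k l" for p
  proof -
    have "partition_on (points k l) p"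
      using that by (simp add: two_row_partitions_def points_def)
    then obtain h :: "nat \<Rightarrow> nat" where
      "T N k l p = mat_of N k l (\<lambda>u v. of_bool (agree (k + l) h (u @ rev v)))"
      by (rule T_labels)
    then show ?thesis
      using hom_labels[of k l h] by (simp add: in_hom_def)
  qed
  moreover have "submodule class_ring (C k l) V"
    using dual by (auto simp: tk_dual_def VectorSpace.subspace_def)
  ultimately show ?thesis
    unfolding hom_P_def by (intro span_is_subset) auto
qed

end

section \<open>Extracting a single crossing\<close>

text \<open>The pairs \<open>{x, y}\<close> and \<open>{u, v}\<close> separate each other on the circle. In this form invariance under rotation
  is evident: moving an initial segment to the end flips an even number of the four comparisons.\<close>

definition separated :: "nat \<Rightarrow> nat \<Rightarrow> nat \<Rightarrow> nat \<Rightarrow> bool" where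
  "separated x y u v \<longleftrightarrow> distinct [x, y, u, v] \<and> (((x < u) \<noteq> (x < v)) \<noteq> ((y < u) \<noteq> (y < v)))"

context dual_over_NC
begin

text \<open>The indices are positions after rotation, with the crossing at 0, \<open>b\<close>,
  \<open>c\<close>, \<open>d\<close>. \<open>same\<close> and \<open>sep\<close> make the blocks
  inside \<open>S\<close> common to all \<open>i\<close> and closed off from the rest;
  \<open>nc\<close> says that the blocks off \<open>S\<close> cross no block. These properties are
  all that the crossing sets contribute.\<close>

lemma hom_crossing_word:
  fixes g :: "'i \<Rightarrow> nat \<Rightarrow> 'b" and \<alpha> :: "'i \<Rightarrow> complex"
  assumes hom: "in_hom 0 k (\<lambda>_ v. \<Sum>i\<in>I. \<alpha> i * of_bool (agree k (g i) v))"
    and I: "finite I"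
    and bcd: "0 < b" "b < c" "c < d" "d < k" and S: "0 \<in> S" "b \<in> S" "c \<in> S" "d \<in> S"
    and same: "\<And>i j x y. i \<in> I \<Longrightarrow> j \<in> I \<Longrightarrow> x \<in> S \<Longrightarrow> y \<in> S \<Longrightarrow> x < k \<Longrightarrow> y < k \<Longrightarrow>
      g i x = g i y \<Longrightarrow> g j x = g j y"
    and sep: "\<And>i x y. i \<in> I \<Longrightarrow> x \<in> S \<Longrightarrow> y \<notin> S \<Longrightarrow> x < k \<Longrightarrow> y < k \<Longrightarrow> g i x \<noteq> g i y"
    and nc: "\<And>i x y u v. i \<in> I \<Longrightarrow> x \<notin> S \<Longrightarrow> x < k \<Longrightarrow> y < k \<Longrightarrow> u < k \<Longrightarrow> v < k \<Longrightarrow>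
      separated x y u v \<Longrightarrow> g i x = g i y \<Longrightarrow> g i u = g i v \<Longrightarrow> g i x = g i u"
    and cross: "\<And>i. i \<in> I \<Longrightarrow> g i 0 = g i c" "\<And>i. i \<in> I \<Longrightarrow> g i b = g i d" "\<And>i. i \<in> I \<Longrightarrow> g i 0 \<noteq> g i b"
    and nonzero: "v0 \<in> words N k" "(\<Sum>i\<in>I. \<alpha> i * of_bool (agree k (g i) v0)) \<noteq> 0"
  shows "in_hom 0 4 (\<lambda>_ w. of_bool (crossing_word w))"
proof -
  define \<xi> where "\<xi> v = (\<Sum>i\<in>I. \<alpha> i * of_bool (agree k (g i) v))" for v
  \<comment> \<open>If xi were orthogonal to the vectors of all \<open>g j\<close>, expanding one
    factor of its squared norm would make the norm zero. These vectors have entries 0 and 1, so only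
    the coefficients are conjugated.\<close>
  have "\<exists>j\<in>I. (\<Sum>v\<in>words N k. \<xi> v * of_bool (agree k (g j) v)) \<noteq> 0"
  proof (rule ccontr)
    assume "\<not> ?thesis"
    then have *: "(\<Sum>v\<in>words N k. \<xi> v * of_bool (agree k (g j) v)) = 0" if "j \<in> I" for j
      using that by blast
    have "(\<Sum>v\<in>words N k. \<xi> v * cnj (\<xi> v)) =
        (\<Sum>v\<in>words N k. \<Sum>j\<in>I. cnj (\<alpha> j) * (\<xi> v * of_bool (agree k (g j) v)))"
      by (subst (2) \<xi>_def) (auto simp: sum_distrib_left mult_ac intro!: sum.cong)
    also have "\<dots> = (\<Sum>j\<in>I. cnj (\<alpha> j) * (\<Sum>v\<in>words N k. \<xi> v * of_bool (agree k (g j) v)))"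
      by (subst sum.swap) (simp only: sum_distrib_left)
    also have "\<dots> = 0"
      using * by simp
    finally have "(\<Sum>v\<in>words N k. complex_of_real ((cmod (\<xi> v))\<^sup>2)) = 0"
      by (simp only: complex_norm_square)
    then have "complex_of_real (\<Sum>v\<in>words N k. (cmod (\<xi> v))\<^sup>2) = 0"
      by (simp only: of_real_sum)
    then have "(\<Sum>v\<in>words N k. (cmod (\<xi> v))\<^sup>2) = 0"
      by (simp only: of_real_eq_0_iff)
    then have "\<forall>v\<in>words N k. (cmod (\<xi> v))\<^sup>2 = 0"
      by (subst (asm) sum_nonneg_eq_0_iff) auto
    then show False
      using nonzero by (simp add: \<xi>_def)
  qed
  then obtain j where j: "j \<in> I" and nz: "(\<Sum>v\<in>words N k. \<xi> v * of_bool (agree k (g j) v)) \<noteq> 0"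
    by blast
  \<comment> \<open>The condition of \<open>g i\<close> splits into a part \<open>q i\<close> off
    \<open>S\<close>, which varies with \<open>i\<close>, and a part \<open>c'\<close> inside
    \<open>S\<close>, which by \<open>same\<close> may be written with the fixed
    \<open>j\<close>.\<close>
  define q where "q i v \<longleftrightarrow> (\<forall>x<k. \<forall>y<k. x \<notin> S \<longrightarrow> y \<notin> S \<longrightarrow> g i x = g i y \<longrightarrow> v ! x = v ! y)"
    for i and v :: "nat list"
  define c' where "c' v \<longleftrightarrow> (\<forall>x<k. \<forall>y<k. x \<in> S \<longrightarrow> y \<in> S \<longrightarrow> g j x = g j y \<longrightarrow> v ! x = v ! y)"
    for v :: "nat list"
  have agree_iff: "agree k (g i) v \<longleftrightarrow> c' v \<and> q i v" if "i \<in> I" for i v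
  proof
    assume *: "agree k (g i) v"
    show "c' v \<and> q i v"
      using * same[OF j that] unfolding agree_def c'_def q_def by blast
  next
    assume *: "c' v \<and> q i v"
    show "agree k (g i) v"
      unfolding agree_def
    proof (intro allI impI)
      fix x y assume xy: "x < k" "y < k" "g i x = g i y"
      then have "x \<in> S \<longleftrightarrow> y \<in> S"
        using sep[OF that, of x y] sep[OF that, of y x] by auto
      then show "v ! x = v ! y"
        using * xy same[OF that j, of x y] unfolding c'_def q_def by blast
    qed
  qed
  \<comment> \<open>The labelling of the contraction from \<open>k\<close> to 4 points. Points of
    \<open>S\<close> get labels of their own, so they are singletons unless a strand starts there;
    the others take the blocks of \<open>g j\<close>. Lower positions run from right to left, hence
    \<open>[d, c, b, 0]\<close>.\<close>
  define h :: "nat \<Rightarrow> nat + 'b" where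
    "h x = (if x < k then if x \<in> S then Inl x else Inr (g j x) else Inl ([d, c, b, 0] ! (x - k)))" for x
  have less_4: "i < 4 \<longleftrightarrow> i = 0 \<or> i = 1 \<or> i = 2 \<or> i = 3" for i :: nat
    by auto
  have all_4: "(\<forall>i<4. P i) \<longleftrightarrow> P 0 \<and> P 1 \<and> P 2 \<and> P 3" for P :: "nat \<Rightarrow> bool"
    unfolding less_4 by blast
  have all_add: "(\<forall>x<k + 4. P x) \<longleftrightarrow> (\<forall>x<k. P x) \<and> (\<forall>i<4. P (k + i))" for P :: "nat \<Rightarrow> bool"
  proof (intro iffI allI impI)
    fix x assume *: "(\<forall>x<k. P x) \<and> (\<forall>i<4. P (k + i))" "x < k + 4"
    show "P x"
    proof (cases "x < k")
      case False
      with * have "x - k < 4" by linarith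
      with * False show ?thesis
        by (metis le_add_diff_inverse not_less)
    qed (use * in blast)
  qed auto
  have h_low: "h (k + i) = Inl ([d, c, b, 0] ! i)" for i
    by (simp add: h_def)
  have strings: "{d, c, b, 0} \<subseteq> S \<and> d < k \<and> c < k \<and> b < k \<and> 0 < k"
    using S bcd by auto
  \<comment> \<open>An arc off \<open>S\<close> over the upper end of a strand would separate 0 from
    \<open>c\<close> or \<open>b\<close> from \<open>d\<close>; \<open>nc\<close> would then put it
    into one of these blocks, against \<open>sep\<close>. As 0 is the first position, no arc passes
    over it.\<close>
  have no_string: "\<not> (x < s \<and> s < y)"
    if "x < k" "y < k" "x \<notin> S" "g j x = g j y" "s \<in> {0, b, c, d}" for x y s
  proof
    assume *: "x < s \<and> s < y"
    have "x \<noteq> 0" "x \<noteq> c" using that(3) S by metis+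
    have y: "y \<notin> S" using sep[OF j, of y x] that by auto
    then have "y \<noteq> c" "y \<noteq> 0" using S by metis+
    have "x < c \<and> c < y \<or> x < b \<and> b < y \<and> y < d \<or> b < x \<and> x < d \<and> d < y"
      using * that(5) bcd \<open>x \<noteq> c\<close> \<open>y \<noteq> c\<close> by (elim insertE) (simp_all, linarith+)
    then have "separated x y 0 c \<or> separated x y b d"
    proof (elim disjE conjE)
      assume "x < c" "c < y"
      then have "separated x y 0 c" using \<open>x \<noteq> 0\<close> \<open>y \<noteq> 0\<close> by (simp add: separated_def)
      then show ?thesis ..
    next
      assume "x < b" "b < y" "y < d"
      then have "separated x y b d" by (simp add: separated_def)
      then show ?thesis ..
    next
      assume "b < x" "x < d" "d < y"
      then have "separated x y b d" by (simp add: separated_def)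
      then show ?thesis ..
    qed
    then have "g j x = g j 0 \<or> g j x = g j b"
      using nc[OF j, of x y 0 c] nc[OF j, of x y b d] that cross[OF j] strings by auto
    then show False
      using sep[OF j, of 0 x] sep[OF j, of b x] that strings by auto
  qed
  have "noncrossing_labels (k + 4) h"
    unfolding noncrossing_labels_def
  proof (intro allI impI)
    fix x u y v assume ord: "x < u" "u < y" "y < v" "v < k + 4" and hx: "h x = h y" and hu: "h u = h v"
    have low: "\<exists>i<4. z = k + i" if "\<not> z < k" "z < k + 4" for z
      using that by (intro exI[of _ "z - k"]) auto
    show "h x = h u"
    proof (cases "v < k")
      case True
      with ord have "x < k" "u < k" "y < k" by auto
      with True hx hu ord have "x \<notin> S" "u \<notin> S" "g j x = g j y" "g j u = g j v"
        by (auto simp: h_def split: if_splits)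
      moreover have "separated x y u v"
        using ord by (auto simp: separated_def)
      ultimately show ?thesis
        using nc[OF j, of x y u v] True \<open>x < k\<close> \<open>u < k\<close> \<open>y < k\<close> by (simp add: h_def)
    next
      case v: False
      then obtain n where n: "v = k + n" "n < 4" using low ord by blast
      show ?thesis
      proof (cases "y < k")
        case True
        with hx ord have x: "x \<notin> S" "g j x = g j y"
          by (auto simp: h_def split: if_splits)
        \<comment> \<open>A lower point shares its label with a single upper point, the other end of
          its strand.\<close>
        have "u = [d, c, b, 0] ! n"
          using hu True ord by (auto simp: n h_low) (auto simp: h_def split: if_splits)
        then have "u \<in> {0, b, c, d}"
          using n(2) unfolding less_4 by auto
        with no_string[of x y u] x True ord show ?thesis by auto
      next
        case False
        then obtain m where m: "y = k + m" "m < 4" using low ord by fastforce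
        show ?thesis
        proof (cases "u < k")
          case True
          \<comment> \<open>Strands are nested in the order of positions: a later lower end belongs
            to an earlier upper end, so \<open>x < u\<close> and \<open>y < v\<close> exclude each
            other.\<close>
          with hx hu ord have "u = [d, c, b, 0] ! n" "x = [d, c, b, 0] ! m"
            by (auto simp: n m h_low) (auto simp: h_def split: if_splits)
          then show ?thesis
            using ord bcd n m by (auto simp: less_4)
        next
          case False
          then obtain l where l: "u = k + l" "l < 4" using low ord by fastforce
          from hu show ?thesis
            using ord bcd l n by (auto simp: h_low less_4)
        qed
      qed
    qed
  qed
  note M = hom_noncrossing[OF this]
  have agree_M: "agree (k + 4) h (v @ rev w) \<longleftrightarrow>
      q j v \<and> w = [v ! 0, v ! b, v ! c, v ! d]" if "length v = k" "length w = 4" for v w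
  proof -
    from that(2) obtain w0 w1 w2 w3 where w: "w = [w0, w1, w2, w3]"
      by (auto simp: length_Suc_conv numeral_eq_Suc)
    have "agree (k + 4) h (v @ rev w) \<longleftrightarrow>
      (\<forall>x<k. (\<forall>y<k. h x = h y \<longrightarrow> v ! x = v ! y) \<and> (\<forall>i<4. h x = h (k + i) \<longrightarrow> v ! x = rev w ! i)) \<and>
      (\<forall>i<4. (\<forall>y<k. h (k + i) = h y \<longrightarrow> rev w ! i = v ! y) \<and>
             (\<forall>i'<4. h (k + i) = h (k + i') \<longrightarrow> rev w ! i = rev w ! i'))"
      unfolding agree_def all_add using that by (simp add: nth_append)
    also have "\<dots> \<longleftrightarrow> q j v \<and> w3 = v ! d \<and> w2 = v ! c \<and> w1 = v ! b \<and> w0 = v ! 0"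
      using strings bcd unfolding all_4 h_low q_def w by (auto simp: h_def split: if_splits)
    finally show ?thesis
      by (auto simp: w)
  qed
  define G where "G w = (\<Sum>v\<in>words N k. \<xi> v * of_bool (agree (k + 4) h (v @ rev w)))" for w
  have hom_G: "in_hom 0 4 (\<lambda>_. G)"
    unfolding G_def \<xi>_def by (rule hom_comp[OF hom M])
  \<comment> \<open>\<open>H\<close> reads only letters off \<open>S\<close>; \<open>W w\<close>
    collects the words that satisfy \<open>c'\<close> and carry the letters of \<open>w\<close> at
    the four chosen places.\<close>
  define H where "H v = (\<Sum>i\<in>I. \<alpha> i * of_bool (q i v)) * of_bool (q j v)" for v
  define W where "W w = {v \<in> words N k. c' v \<and> w = [v ! 0, v ! b, v ! c, v ! d]}" for w
  have G: "G w = (\<Sum>v\<in>W w. H v)" if "w \<in> words N 4" for w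
  proof -
    have "\<xi> v = of_bool (c' v) * (\<Sum>i\<in>I. \<alpha> i * of_bool (q i v))" for v
      unfolding \<xi>_def sum_distrib_left by (rule sum.cong) (auto simp: agree_iff)
    then have "G w = (\<Sum>v\<in>words N k. if c' v \<and> w = [v ! 0, v ! b, v ! c, v ! d] then H v else 0)"
      unfolding G_def using that
      by (intro sum.cong refl) (auto simp: agree_M words_lengthD H_def)
    then show ?thesis
      by (simp add: W_def sum.inter_filter)
  qed
  have G_zero: "G w = 0" if "w \<in> words N 4" "\<not> crossing_word w" for w
  proof -
    have "v ! 0 = v ! c" "v ! b = v ! d" if "c' v" for v
      using that strings cross[OF j] unfolding c'_def by auto
    then have "W w = {}"
      using that(2) by (auto simp: W_def crossing_word_def)
    then show ?thesis
      using G[OF that(1)] by simp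
  qed
  \<comment> \<open>Overwriting the blocks of 0 and \<open>b\<close> by new letters maps one set
    \<open>W\<close> bijectively onto the other. It touches only \<open>S\<close>, so
    \<open>H\<close> does not change.\<close>
  have G_const: "G [s, t, s, t] = G [s', t', s', t']" if "s < N" "t < N" "s' < N" "t' < N" for s t s' t'
  proof -
    define upd where "upd s t v = map (\<lambda>x. if x \<in> S \<and> g j x = g j 0 then s
      else if x \<in> S \<and> g j x = g j b then t else v ! x) [0..<k]" for s t :: nat and v
    have upd_nth: "upd s t v ! x = (if x \<in> S \<and> g j x = g j 0 then s
      else if x \<in> S \<and> g j x = g j b then t else v ! x)" if "x < k" for s t v x
      using that by (simp add: upd_def)
    have upd_W: "upd s' t' v \<in> W [s', t', s', t']"
      if "v \<in> W [s, t, s, t]" "s' < N" "t' < N" for s t s' t' v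
    proof -
      have "upd s' t' v \<in> words N k"
        using that by (auto simp: words_def upd_def W_def words_nthD)
      moreover have "c' (upd s' t' v)"
        unfolding c'_def
      proof (intro allI impI)
        fix x y assume xy: "x < k" "y < k" "x \<in> S" "y \<in> S" "g j x = g j y"
        then have "v ! x = v ! y"
          using that unfolding c'_def W_def by blast
        with xy show "upd s' t' v ! x = upd s' t' v ! y"
          by (simp add: upd_nth)
      qed
      ultimately show ?thesis
        using strings cross[OF j] by (auto simp: W_def upd_nth)
    qed
    have upd_upd: "upd s t (upd s' t' v) = v" if "v \<in> W [s, t, s, t]" for s t s' t' v
    proof (rule nth_equalityI)
      have v: "v \<in> words N k" "c' v" "s = v ! 0" "t = v ! b"
        using that by (auto simp: W_def)
      then show "length (upd s t (upd s' t' v)) = length v"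
        by (simp add: upd_def words_lengthD)
      fix x assume "x < length (upd s t (upd s' t' v))"
      then have "x < k" by (simp add: upd_def)
      moreover have "v ! x = s" if "x \<in> S" "g j x = g j 0"
        using v(2,3) strings that \<open>x < k\<close> unfolding c'_def by blast
      moreover have "v ! x = t" if "x \<in> S" "g j x = g j b"
        using v(2,4) strings that \<open>x < k\<close> unfolding c'_def by blast
      ultimately show "upd s t (upd s' t' v) ! x = v ! x"
        by (simp add: upd_nth)
    qed
    have q_upd: "q i (upd s t v) = q i v" for i s t v
      unfolding q_def by (auto simp: upd_nth)
    have "(\<Sum>v\<in>W [s, t, s, t]. H v) = (\<Sum>v\<in>W [s', t', s', t']. H v)"
      by (rule sum.reindex_bij_witness[where i = "upd s t" and j = "upd s' t'"])
        (use that in \<open>auto simp: upd_upd upd_W H_def q_upd\<close>)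
    then show ?thesis
      using that by (simp add: G words_def)
  qed
  have G_eq: "G w = G [0, 0, 0, 0] * of_bool (crossing_word w)" if w: "w \<in> words N 4" for w
  proof -
    obtain w0 w1 w2 w3 where w: "w = [w0, w1, w2, w3]"
      using words_lengthD[OF w] by (auto simp: length_Suc_conv numeral_eq_Suc)
    then have "w0 < N" "w1 < N" using that by (auto simp: words_def)
    then show ?thesis
      using G_zero[OF that] G_const[of w0 w1 0 0] N by (auto simp: w crossing_word_def)
  qed
  \<comment> \<open>The upper word determines the four lower letters, so summing over all
    \<open>w\<close> removes the strands. The sum of the entries of \<open>G\<close> is therefore
    the pairing of xi with the vector of \<open>g j\<close>.\<close>
  have "G [0, 0, 0, 0] \<noteq> 0"
  proof
    assume "G [0, 0, 0, 0] = 0"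
    then have "(\<Sum>w\<in>words N 4. G w) = 0"
      using G_eq by simp
    moreover have "(\<Sum>w\<in>words N 4. G w) = (\<Sum>v\<in>words N k. \<Sum>w\<in>words N 4. \<xi> v * of_bool (agree (k + 4) h (v @ rev w)))"
      unfolding G_def by (rule sum.swap)
    moreover have "\<dots> = (\<Sum>v\<in>words N k. \<xi> v * of_bool (agree k (g j) v))"
    proof (rule sum.cong)
      fix v assume v: "v \<in> words N k"
      let ?w = "[v ! 0, v ! b, v ! c, v ! d]"
      have w: "?w \<in> words N 4"
        using words_nthD[OF v] strings by (auto simp: words_def)
      have "(\<Sum>w\<in>words N 4. \<xi> v * of_bool (agree (k + 4) h (v @ rev w))) =
          \<xi> v * of_bool (agree (k + 4) h (v @ rev ?w))"
        using words_lengthD[OF v] by (intro sum_only[OF _ w]) (auto simp: agree_M words_lengthD)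
      also have "\<dots> = \<xi> v * of_bool (q j v)"
        by (subst agree_M) (simp_all add: words_lengthD[OF v])
      \<comment> \<open>Where \<open>c'\<close> fails, xi vanishes; where it holds,
        \<open>q j\<close> is the same as agreement with \<open>g j\<close>.\<close>
      also have "\<dots> = \<xi> v * of_bool (agree k (g j) v)"
      proof (cases "c' v")
        case False
        then have "\<xi> v = 0"
          unfolding \<xi>_def by (intro sum.neutral) (auto simp: agree_iff)
        then show ?thesis by simp
      qed (simp add: agree_iff j)
      finally show "(\<Sum>w\<in>words N 4. \<xi> v * of_bool (agree (k + 4) h (v @ rev w))) =
        \<xi> v * of_bool (agree k (g j) v)" .
    qed simp
    ultimately show False
      using nz by simp
  qed
  then show ?thesis
    using hom_scale[OF hom_G, of "inverse (G [0, 0, 0, 0])"]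
    by (elim hom_cong) (simp add: G_eq)
qed

end

section \<open>Crossing blocks\<close>

lemma separated_ordered:
  assumes sep: "separated x y u v"
  obtains a b c d where "a < b" "b < c" "c < d"
    "{x, y} = {a, c} \<and> {u, v} = {b, d} \<or> {x, y} = {b, d} \<and> {u, v} = {a, c}"
proof -
  note ordered = that
  \<comment> \<open>The case of two increasing pairs; the others reduce to it, as
    \<open>separated\<close> is symmetric within each pair.\<close>
  have *: thesis if "separated x' y' u' v'" "x' < y'" "u' < v'" "{x', y'} = {x, y}" "{u', v'} = {u, v}" for x' y' u' v'
  proof -
    have "x' < u' \<and> u' < y' \<and> y' < v' \<or> u' < x' \<and> x' < v' \<and> v' < y'"
      using that(1-3) unfolding separated_def by (simp, linarith)
    then show thesis
    proof (elim disjE conjE)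
      assume "x' < u'" "u' < y'" "y' < v'"
      then show thesis by (rule ordered) (simp add: that(4,5))
    next
      assume "u' < x'" "x' < v'" "v' < y'"
      then show thesis by (rule ordered) (simp add: that(4,5))
    qed
  qed
  have sym: "separated y x u v" "separated x y v u" "separated y x v u" "x \<noteq> y" "u \<noteq> v"
    using sep unfolding separated_def by (simp_all, argo+)
  show thesis
  proof (cases "x < y")
    case True
    then show thesis
      using *[OF sep] *[OF sym(2)] sym by (cases "u < v") (simp_all add: insert_commute)
  next
    case False
    then show thesis
      using *[OF sym(1)] *[OF sym(3)] sym by (cases "u < v") (simp_all add: insert_commute)
  qed
qed

text \<open>Crossings are stored as plain sets; the increasing enumeration recovers the order and
  with it the pairing.\<close>

lemma ordered_set_eqD:
  fixes a b c d :: nat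
  assumes "{a, b, c, d} = {a', b', c', d'}" "a < b" "b < c" "c < d" "a' < b'" "b' < c'" "c' < d'"
  shows "a = a' \<and> b = b' \<and> c = c' \<and> d = d'"
proof -
  have "[a, b, c, d] = [a', b', c', d']"
    using assms by (intro sorted_distinct_set_unique) auto
  then show ?thesis by simp
qed

text \<open>The order of four points forces which of them are joined, so membership in
  \<open>cr p\<close> decides the block relations among them. In this symmetric form a crossing can
  be carried from one partition to another without sorting its points.\<close>

lemma crossing_mem_cr_iff:
  assumes p: "partition_on A p" and sep: "separated x y u v"
  shows "{x, y, u, v} \<in> cr p \<longleftrightarrow> same_block p x y \<and> same_block p u v \<and> \<not> same_block p x u"
    (is "?L \<longleftrightarrow> ?R")
proof -
  note sym = same_block_sym[of p] and trans = same_block_trans[OF p]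
  obtain a b c d where ord: "a < b" "b < c" "c < d"
    and sets: "{x, y} = {a, c} \<and> {u, v} = {b, d} \<or> {x, y} = {b, d} \<and> {u, v} = {a, c}"
    using separated_ordered[OF sep] .
  have "{x, y, u, v} = {x, y} \<union> {u, v}"
    by blast
  also have "\<dots> = {a, b, c, d}"
    using sets by auto
  finally have set: "{x, y, u, v} = {a, b, c, d}" .
  have "?L \<longleftrightarrow> same_block p a c \<and> same_block p b d \<and> \<not> same_block p a b"
  proof
    assume ?L
    then obtain a' b' c' d' where *: "{a, b, c, d} = {a', b', c', d'}" "a' < b'" "b' < c'" "c' < d'"
      "same_block p a' c'" "same_block p b' d'" "\<not> same_block p a' b'"
      unfolding set cr_def is_crossing_def by blast
    with ordered_set_eqD[OF *(1) ord *(2-4)] show "same_block p a c \<and> same_block p b d \<and> \<not> same_block p a b"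
      by simp
  next
    assume "same_block p a c \<and> same_block p b d \<and> \<not> same_block p a b"
    then show ?L
      unfolding set cr_def is_crossing_def using ord by blast
  qed
  also have "\<dots> \<longleftrightarrow> ?R"
    using sets unfolding doubleton_eq_iff by (elim disjE conjE) (metis sym trans)+
  finally show ?thesis .
qed

lemma mem_Union_cr_iff:
  assumes p: "partition_on A p"
  shows "x \<in> \<Union>(cr p) \<longleftrightarrow>
    (\<exists>y u v. separated x y u v \<and> same_block p x y \<and> same_block p u v \<and> \<not> same_block p x u)"
proof
  assume "x \<in> \<Union>(cr p)"
  then obtain a b c d where x: "x \<in> {a, b, c, d}" and ord: "a < b" "b < c" "c < d"
    and *: "same_block p a c" "same_block p b d" "\<not> same_block p a b"
    unfolding cr_def is_crossing_def by blast
  note sym = same_block_sym[of p] and trans = same_block_trans[OF p]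
  have "\<not> same_block p b a" "\<not> same_block p c b" "\<not> same_block p d a"
    using * sym trans by metis+
  moreover have "separated a c b d" "separated b d a c" "separated c a b d" "separated d b a c"
    using ord by (auto simp: separated_def)
  ultimately show "\<exists>y u v. separated x y u v \<and> same_block p x y \<and> same_block p u v \<and> \<not> same_block p x u"
    using x * sym by (elim insertE) blast+
next
  assume "\<exists>y u v. separated x y u v \<and> same_block p x y \<and> same_block p u v \<and> \<not> same_block p x u"
  then obtain y u v where "{x, y, u, v} \<in> cr p"
    using crossing_mem_cr_iff[OF p] by blast
  then show "x \<in> \<Union>(cr p)" by blast
qed

text \<open>Either \<open>x\<close> and \<open>y\<close> are separated by a crossing, or a third point of their block is separated from both.
  Hence the set of crossings determines all blocks that cross another block.\<close>

lemma crossing_block: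
  assumes p: "partition_on A p" "partition_on A p'" and cr: "cr p = cr p'"
    and x: "x \<in> \<Union>(cr p)" and xy: "same_block p x y"
  shows "same_block p' x y" and "y \<in> \<Union>(cr p)"
proof -
  note sym = same_block_sym[of p] and trans = same_block_trans[OF p(1)]
  obtain z u v where sep: "separated x z u v" and *: "same_block p x z" "same_block p u v" "\<not> same_block p x u"
    using x mem_Union_cr_iff[OF p(1)] by blast
  have xz: "{x, z, u, v} \<in> cr p"
    using crossing_mem_cr_iff[OF p(1) sep] * by blast
  have xz': "same_block p' x z"
    using crossing_mem_cr_iff[OF p(2) sep] xz cr by blast
  have "same_block p' x y \<and> y \<in> \<Union>(cr p)"
  proof (cases "y = x \<or> y = z")
    case True
    have "x \<in> A" using same_block_in[OF p(1) xy] by blast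
    then have "same_block p' x x"
      by (rule same_block_refl[OF p(2)])
    with True xz xz' show ?thesis by blast
  next
    case False
    have "y \<noteq> u" "y \<noteq> v"
      using xy * sym trans by metis+
    \<comment> \<open>\<open>u\<close> and \<open>v\<close> cut the circle into two arcs, with
      \<open>x\<close> in one and \<open>z\<close> in the other; \<open>y\<close> lies in one of
      them and is separated from the point in the other.\<close>
    with False sep consider "separated x y u v" | "separated y z u v"
      by (auto simp: separated_def)
    then show ?thesis
    proof cases
      case 1
      then have "{x, y, u, v} \<in> cr p"
        using crossing_mem_cr_iff[OF p(1) 1] * xy by blast
      then show ?thesis
        using crossing_mem_cr_iff[OF p(2) 1] unfolding cr[symmetric] by blast
    next
      case 2
      have "same_block p y z" "\<not> same_block p y u"
        using * xy sym trans by metis+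
      then have "{y, z, u, v} \<in> cr p"
        using crossing_mem_cr_iff[OF p(1) 2] * by blast
      then have "same_block p' y z" "y \<in> \<Union>(cr p)"
        using crossing_mem_cr_iff[OF p(2) 2] unfolding cr[symmetric] by blast+
      with xz' show ?thesis
        by (metis same_block_sym same_block_trans[OF p(2)])
    qed
  qed
  then show "same_block p' x y" "y \<in> \<Union>(cr p)" by simp_all
qed

section \<open>Rotation of the points on the circle\<close>

lemma separated_rotate:
  assumes "x < k" "y < k" "u < k" "v < k"
  shows "separated ((x + r) mod k + 1) ((y + r) mod k + 1) ((u + r) mod k + 1) ((v + r) mod k + 1)
    \<longleftrightarrow> separated x y u v"
proof -
  define t where "t x = (x + r) mod k + 1" for x
  define r' where "r' = r mod k"
  have r': "r' < k"
    using assms(1) by (simp add: r'_def)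
  \<comment> \<open>\<open>s x\<close> says that \<open>x\<close> is not wrapped around. The shift
    reverses the order of two points exactly when one of them wraps and the other does not.\<close>
  define s where "s x \<longleftrightarrow> x + r' < k" for x
  have t: "t x = (if s x then x + r' + 1 else x + r' - k + 1)" if "x < k" for x
  proof -
    have "(x + r) mod k = (x + r') mod k"
      by (simp add: r'_def mod_simps)
    also have "\<dots> = (if s x then x + r' else x + r' - k)"
      using that r' by (simp add: s_def mod_if)
    finally show ?thesis
      by (simp add: t_def)
  qed
  have less: "t x < t y \<longleftrightarrow> ((x < y) \<noteq> (s x \<noteq> s y))" if "x < k" "y < k" "x \<noteq> y" for x y
  proof -
    have "x < y \<or> y < x" using that by linarith
    then show ?thesis
      unfolding t[OF that(1)] t[OF that(2)] using that(1,2) r'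
      by (cases "s x"; cases "s y") (auto simp: s_def)
  qed
  have eq: "t x = t y \<longleftrightarrow> x = y" if "x < k" "y < k" for x y
    using less[OF that] less[OF that(2,1)] by (cases "x = y") (auto simp: linorder_neq_iff)
  show ?thesis
  proof (cases "distinct [x, y, u, v]")
    case True
    then have "t x < t u \<longleftrightarrow> ((x < u) \<noteq> (s x \<noteq> s u))" "t x < t v \<longleftrightarrow> ((x < v) \<noteq> (s x \<noteq> s v))"
      "t y < t u \<longleftrightarrow> ((y < u) \<noteq> (s y \<noteq> s u))" "t y < t v \<longleftrightarrow> ((y < v) \<noteq> (s y \<noteq> s v))"
      using less assms by simp_all
    moreover have "distinct [t x, t y, t u, t v]"
      using True assms by (simp add: eq)
    ultimately show ?thesis
      unfolding t_def[symmetric] separated_def using True by (simp only: simp_thms) argo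
  next
    case False
    then have "\<not> distinct [t x, t y, t u, t v]"
      using assms by (auto simp: eq)
    with False show ?thesis
      unfolding t_def[symmetric] separated_def by blast
  qed
qed

section \<open>One-row partitions as labellings\<close>

definition block_of :: "'a set set \<Rightarrow> 'a \<Rightarrow> 'a set" where
  "block_of p x = {y. same_block p x y}"

lemma block_of_eq_iff:
  assumes "partition_on A p" "x \<in> A" "y \<in> A"
  shows "block_of p x = block_of p y \<longleftrightarrow> same_block p x y"
proof
  assume "block_of p x = block_of p y"
  then show "same_block p x y"
    using same_block_refl[OF assms(1,3)] by (auto simp: block_of_def)
next
  assume *: "same_block p x y"
  then show "block_of p x = block_of p y"
    using same_block_sym[OF *] unfolding block_of_def
    by (intro Collect_cong) (metis same_block_trans[OF assms(1)])
qed

text \<open>The outputs are read from left to right here, in contrast to the positions used for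
  \<open>T\<close>; list index \<open>x\<close> is the point \<open>x + 1\<close>.\<close>

lemma xi_mat_of:
  assumes "partition_on {1..k} p"
  shows "xi N k p = mat_of N 0 k (\<lambda>_ v. of_bool (agree k (\<lambda>x. block_of p (x + 1)) v))"
proof -
  have "(\<forall>x\<in>{1..k}. \<forall>y\<in>{1..k}. same_block p x y \<longrightarrow> digit N k a x = digit N k a y) \<longleftrightarrow>
      agree k (\<lambda>x. block_of p (x + 1)) (word N k a)" for a
  proof -
    have "{1..k} = Suc ` {..<k}"
      by (simp add: image_Suc_lessThan)
    then show ?thesis
      using block_of_eq_iff[OF assms] unfolding agree_def by (auto simp: word_nth)
  qed
  then show ?thesis
    unfolding xi_def mat_of_def by (intro eq_matI) (auto simp: of_bool_def)
qed

lemma finsum_xi: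
  assumes "finite I" "\<And>i. i \<in> I \<Longrightarrow> partition_on {1..k} (p i)"
  shows "finsum (mat_space (N ^ k) 1) (\<lambda>i. \<alpha> i \<cdot>\<^sub>m xi N k (p i)) I =
    mat_of N 0 k (\<lambda>_ v. \<Sum>i\<in>I. \<alpha> i * of_bool (agree k (\<lambda>x. block_of (p i) (x + 1)) v))"
proof -
  interpret matrix_vs "N ^ k" "N ^ 0" "TYPE(complex)" .
  have "finsum V (\<lambda>i. \<alpha> i \<cdot>\<^sub>m xi N k (p i)) I = finsum V
    (\<lambda>i. mat_of N 0 k (\<lambda>_ v. \<alpha> i * of_bool (agree k (\<lambda>x. block_of (p i) (x + 1)) v))) I"
    by (rule finsum_cong') (auto simp: xi_mat_of[OF assms(2)] mat_of_smult mat_of_def)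
  also have "\<dots> = mat_of N 0 k (\<lambda>_ v. \<Sum>i\<in>I. \<alpha> i * of_bool (agree k (\<lambda>x. block_of (p i) (x + 1)) v))"
    by (rule finsum_mat_of[OF assms(1)])
  finally show ?thesis
    by simp
qed

text \<open>Letter \<open>x\<close> of \<open>v\<close> stands at place \<open>(x + r) mod k\<close>
  of the rotated word, and this reindexing is a bijection of the places.\<close>

lemma agree_rotate:
  assumes "length v = k" "r \<le> k"
  shows "agree k h (rotate (k - r) v) \<longleftrightarrow> agree k (\<lambda>x. h ((x + r) mod k)) v"
proof (cases "k = 0")
  case False
  let ?t = "\<lambda>x. (x + r) mod k"
  have inv: "(k - r + (x + r) mod k) mod k = x" if "x < k" for x
    using that assms(2) mod_add_right_eq[of "k - r" "x + r" k] by simp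
  have inv': "((k - r + x) mod k + r) mod k = x" if "x < k" for x
    using that assms(2) mod_add_left_eq[of "k - r + x" k r] by simp
  have range: "{..<k} = ?t ` {..<k}"
  proof
    show "{..<k} \<subseteq> ?t ` {..<k}"
    proof
      fix x assume "x \<in> {..<k}"
      then show "x \<in> ?t ` {..<k}"
        using inv'[of x] False by (intro image_eqI[of _ _ "(k - r + x) mod k"]) auto
    qed
  qed (use False in auto)
  have "agree k h (rotate (k - r) v) \<longleftrightarrow>
      (\<forall>x\<in>{..<k}. \<forall>y\<in>{..<k}. h x = h y \<longrightarrow> rotate (k - r) v ! x = rotate (k - r) v ! y)"
    by (auto simp: agree_def)
  also have "\<dots> \<longleftrightarrow> (\<forall>x<k. \<forall>y<k. h (?t x) = h (?t y) \<longrightarrow> rotate (k - r) v ! ?t x = rotate (k - r) v ! ?t y)"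
    by (subst range, subst range) auto
  also have "\<dots> \<longleftrightarrow> agree k (\<lambda>x. h (?t x)) v"
    unfolding agree_def using assms(1) False by (simp add: nth_rotate inv)
  finally show ?thesis .
qed (simp add: agree_def)

context dual_over_NC
begin

text \<open>\<open>crossing_block\<close> and \<open>separated_rotate\<close> supply the hypotheses
  of \<open>hom_crossing_word\<close>.\<close>

lemma hom_crossing_if_same_crossings:
  assumes p: "\<And>i. i \<in> I \<Longrightarrow> p i \<in> CR k" and I: "finite I"
    and cr: "\<And>i j. i \<in> I \<Longrightarrow> j \<in> I \<Longrightarrow> cr (p i) = cr (p j)"
    and \<xi>: "\<xi> = finsum (mat_space (N ^ k) 1) (\<lambda>i. \<alpha> i \<cdot>\<^sub>m xi N k (p i)) I"
    and \<xi>_in: "\<xi> \<in> C 0 k" and nonzero: "\<xi> \<noteq> 0\<^sub>m (N ^ k) 1"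
  shows "in_hom 0 4 (\<lambda>_ w. of_bool (crossing_word w))"
proof -
  have part: "partition_on {1..k} (p i)" if "i \<in> I" for i
    using p[OF that] by (simp add: CR_def)
  define F where "F v = (\<Sum>i\<in>I. \<alpha> i * of_bool (agree k (\<lambda>x. block_of (p i) (x + 1)) v))" for v
  have \<xi>_F: "\<xi> = mat_of N 0 k (\<lambda>_. F)"
    unfolding \<xi> F_def[abs_def] by (rule finsum_xi[OF I part])
  then have hom_F: "in_hom 0 k (\<lambda>_. F)"
    using \<xi>_in by (simp add: in_hom_def)
  have "\<exists>w\<in>words N k. F w \<noteq> 0"
  proof (rule ccontr)
    assume "\<not> ?thesis"
    then have "mat_of N 0 k (\<lambda>_. F) = mat_of N 0 k (\<lambda>_ _. 0)"
      by (intro mat_of_cong) auto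
    then show False
      using nonzero \<xi>_F mat_of_zero[of N k 0] by simp
  qed
  then obtain w where w: "w \<in> words N k" "F w \<noteq> 0" by blast
  have "I \<noteq> {}"
  proof
    assume "I = {}"
    with w show False by (simp add: F_def)
  qed
  then obtain i0 where i0: "i0 \<in> I" by blast
  then obtain a b c d where ord: "a < b" "b < c" "c < d"
    and acbd: "same_block (p i0) a c" "same_block (p i0) b d" "\<not> same_block (p i0) a b"
    using p[OF i0] by (auto simp: CR_def cr_def is_crossing_def)
  have sep: "separated a c b d"
    using ord by (auto simp: separated_def)
  have mem: "{a, c, b, d} \<in> cr (p i)" if "i \<in> I" for i
    using crossing_mem_cr_iff[OF part[OF i0] sep] acbd cr[OF i0 that] by blast
  have cross: "same_block (p i) a c" "same_block (p i) b d" "\<not> same_block (p i) a b" if "i \<in> I" for i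
    using crossing_mem_cr_iff[OF part[OF that] sep] mem[OF that] by blast+
  have range: "a \<ge> 1" "d \<le> k"
    using same_block_in[OF part[OF i0] acbd(1)] same_block_in[OF part[OF i0] acbd(2)] by auto
  \<comment> \<open>\<open>t\<close> leads from positions after rotation, counted from 0, to points
    of \<open>{1..k}\<close>. The shift by \<open>a - 1\<close> makes position 0 the point
    \<open>a\<close>.\<close>
  define r where "r = a - 1"
  define t where "t x = (x + r) mod k + 1" for x
  have t_in: "t x \<in> {1..k}" if "x < k" for x
    using that by (simp add: t_def Suc_leI)
  have t_diff: "t (x - a) = x" if "a \<le> x" "x \<le> k" for x
    using that range ord by (simp add: t_def r_def)
  define g where "g i x = block_of (p i) (t x)" for i x
  have g_iff: "g i x = g i y \<longleftrightarrow> same_block (p i) (t x) (t y)" if "i \<in> I" "x < k" "y < k" for i x y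
    unfolding g_def using block_of_eq_iff[OF part[OF that(1)] t_in t_in] that by simp
  \<comment> \<open>The points in crossings, seen after the rotation; any index could replace
    \<open>i0\<close>, as all crossing sets are equal.\<close>
  define S where "S = {x. t x \<in> \<Union>(cr (p i0))}"
  have S_iff: "x \<in> S \<longleftrightarrow> t x \<in> \<Union>(cr (p i))" if "i \<in> I" for i x
    using cr[OF that i0] by (simp add: S_def)
  have F_rotate: "F (rotate (k - r) v) = (\<Sum>i\<in>I. \<alpha> i * of_bool (agree k (g i) v))" if "v \<in> words N k" for v
  proof -
    have "r \<le> k"
      using range ord by (simp add: r_def)
    then show ?thesis
      unfolding F_def g_def t_def by (simp only: agree_rotate[OF words_lengthD[OF that]])
  qed
  have hom: "in_hom 0 k (\<lambda>_ v. \<Sum>i\<in>I. \<alpha> i * of_bool (agree k (g i) v))"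
    using hom_rotate[OF hom_F, of "k - r"] by (rule hom_cong) (rule F_rotate)
  have "rotate (k - r) (rotate r w) = w"
    using words_lengthD[OF w(1)] range ord by (simp add: rotate_rotate r_def rotate_id)
  moreover have "rotate r w \<in> words N k"
    using w(1) by (simp add: words_def)
  ultimately have v0: "rotate r w \<in> words N k"
    "(\<Sum>i\<in>I. \<alpha> i * of_bool (agree k (g i) (rotate r w))) \<noteq> 0"
    using F_rotate[of "rotate r w"] w(2) by simp_all
  have less_k: "c - a < k" "b - a < k" "d - a < k" "0 < k"
    using ord range by auto
  have ta: "t 0 = a" "t (b - a) = b" "t (c - a) = c" "t (d - a) = d"
    using t_diff[of a] t_diff[of b] t_diff[of c] t_diff[of d] ord range by simp_all
  have same: "same_block (p j) (t x) (t y)" if "i \<in> I" "j \<in> I" "x \<in> S" "same_block (p i) (t x) (t y)" for i j x y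
    using crossing_block(1)[OF part[OF that(1)] part[OF that(2)] cr[OF that(1,2)]] that S_iff by blast
  have closed: "y \<in> S" if "i \<in> I" "x \<in> S" "same_block (p i) (t x) (t y)" for i x y
    using crossing_block(2)[OF part[OF that(1)] part[OF that(1)] refl] that S_iff by blast
  show ?thesis
  proof (rule hom_crossing_word[OF hom I, of "b - a" "c - a" "d - a" S "rotate r w"])
    show "0 < b - a" "b - a < c - a" "c - a < d - a" "d - a < k"
      using ord range by auto
    show "0 \<in> S" "b - a \<in> S" "c - a \<in> S" "d - a \<in> S"
      unfolding S_def mem_Collect_eq ta using mem[OF i0] by blast+
    show "g j x = g j y" if "i \<in> I" "j \<in> I" "x \<in> S" "y \<in> S" "x < k" "y < k" "g i x = g i y" for i j x y
      using that same g_iff by blast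
    show "g i x \<noteq> g i y" if "i \<in> I" "x \<in> S" "y \<notin> S" "x < k" "y < k" for i x y
      using that closed g_iff by blast
    show "g i x = g i u"
      if "i \<in> I" "x \<notin> S" "x < k" "y < k" "u < k" "v < k" "separated x y u v" "g i x = g i y" "g i u = g i v"
      for i x y u v
    proof (rule ccontr)
      \<comment> \<open>Two different blocks with separated pairs form a crossing, which would put
        \<open>x\<close> into \<open>S\<close>.\<close>
      assume "g i x \<noteq> g i u"
      moreover have "separated (t x) (t y) (t u) (t v)"
        using that separated_rotate[of x k y u v r] by (simp add: t_def)
      ultimately have "t x \<in> \<Union>(cr (p i))"
        using that g_iff mem_Union_cr_iff[OF part[OF that(1)], of "t x"] by blast
      then show False
        using that S_iff by blast
    qed
    show "g i 0 = g i (c - a)" "g i (b - a) = g i (d - a)" "g i 0 \<noteq> g i (b - a)" if "i \<in> I" for i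
      using cross[OF that] g_iff[OF that] less_k by (simp_all add: ta)
  qed (use v0 in simp_all)
qed

end

section \<open>The spaces of partitions as invariants of the symmetric group\<close>

definition invariant :: "nat \<Rightarrow> nat \<Rightarrow> nat \<Rightarrow> (nat list \<Rightarrow> nat list \<Rightarrow> complex) \<Rightarrow> bool" where
  "invariant N k l F \<longleftrightarrow> (\<forall>\<sigma>. \<sigma> permutes {..<N} \<longrightarrow>
     (\<forall>u\<in>words N k. \<forall>v\<in>words N l. F (map \<sigma> u) (map \<sigma> v) = F u v))"

lemma invariantI:
  assumes "\<And>\<sigma> u v. \<sigma> permutes {..<N} \<Longrightarrow> u \<in> words N k \<Longrightarrow> v \<in> words N l \<Longrightarrow>
    F (map \<sigma> u) (map \<sigma> v) = F u v"
  shows "invariant N k l F"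
  using assms by (simp add: invariant_def)

lemma invariantD:
  assumes "invariant N k l F" "\<sigma> permutes {..<N}" "u \<in> words N k" "v \<in> words N l"
  shows "F (map \<sigma> u) (map \<sigma> v) = F u v"
  using assms by (simp add: invariant_def)

lemma map_permutes_words: "\<sigma> permutes {..<N} \<Longrightarrow> u \<in> words N k \<Longrightarrow> map \<sigma> u \<in> words N k"
  using permutes_image[of \<sigma> "{..<N}"] by (fastforce simp: words_def)

lemma map_permutes_inj: "\<sigma> permutes A \<Longrightarrow> map \<sigma> u = map \<sigma> v \<longleftrightarrow> u = v"
  by (meson inj_eq inj_mapI permutes_inj)

lemma sum_map_permutes:
  assumes "\<sigma> permutes {..<N}"
  shows "(\<Sum>v\<in>words N k. f (map \<sigma> v)) = (\<Sum>v\<in>words N k. f v)"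
proof (rule sum.reindex_bij_betw)
  show "bij_betw (map \<sigma>) (words N k) (words N k)"
  proof (rule bij_betw_byWitness[where f' = "map (inv_into UNIV \<sigma>)"])
    show "map \<sigma> ` words N k \<subseteq> words N k" "map (inv_into UNIV \<sigma>) ` words N k \<subseteq> words N k"
      using map_permutes_words assms permutes_inv[OF assms] by blast+
  qed (simp_all add: permutes_inv_o[OF assms])
qed

section \<open>Orbits of the symmetric group on words\<close>

lemma extend_to_permutation:
  assumes "finite S" "A \<subseteq> S" "B \<subseteq> S" "bij_betw f A B"
  obtains \<sigma> where "\<sigma> permutes S" "\<And>x. x \<in> A \<Longrightarrow> \<sigma> x = f x"
proof -
  have fin: "finite A" "finite B"
    using assms by (auto dest: finite_subset)
  \<comment> \<open>The complements have equal size, so any bijection between them completes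
    \<open>f\<close>.\<close>
  have "card (S - A) = card (S - B)"
    using assms fin bij_betw_same_card[OF assms(4)] by (simp add: card_Diff_subset)
  then obtain g where g: "bij_betw g (S - A) (S - B)"
    using finite_same_card_bij[OF finite_Diff[OF assms(1)] finite_Diff[OF assms(1)]] by metis
  define \<sigma> where "\<sigma> x = (if x \<in> A then f x else if x \<in> S then g x else x)" for x
  have "bij_betw \<sigma> A B \<longleftrightarrow> bij_betw f A B"
    by (rule bij_betw_cong) (simp add: \<sigma>_def)
  moreover have "bij_betw \<sigma> (S - A) (S - B) \<longleftrightarrow> bij_betw g (S - A) (S - B)"
    by (rule bij_betw_cong) (simp add: \<sigma>_def)
  ultimately have "bij_betw \<sigma> A B" "bij_betw \<sigma> (S - A) (S - B)"
    using assms(4) g by simp_all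
  then have "bij_betw \<sigma> (A \<union> (S - A)) (B \<union> (S - B))"
    by (rule bij_betw_combine) auto
  moreover have "A \<union> (S - A) = S" "B \<union> (S - B) = S"
    using assms by auto
  ultimately have "\<sigma> permutes S"
    using assms(2) by (intro bij_imp_permutes) (auto simp: \<sigma>_def)
  then show thesis
    by (rule that) (simp add: \<sigma>_def)
qed

text \<open>This relation describes the orbits of the symmetric group on words: a relabelling
  preserves exactly which letters coincide.\<close>

definition same_pattern :: "'a list \<Rightarrow> 'a list \<Rightarrow> bool" where
  "same_pattern z w \<longleftrightarrow> length z = length w \<and> (\<forall>x<length z. \<forall>y<length z. z ! x = z ! y \<longleftrightarrow> w ! x = w ! y)"

lemma same_pattern_permutes:
  assumes "same_pattern z w" "set z \<subseteq> S" "set w \<subseteq> S" "finite S"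
  obtains \<sigma> where "\<sigma> permutes S" "w = map \<sigma> z"
proof -
  \<comment> \<open>The image of a letter of \<open>z\<close> is read off \<open>w\<close> at any of
    its places; equal patterns make this independent of the choice.\<close>
  define i where "i a = (SOME j. j < length z \<and> z ! j = a)" for a
  have i: "i a < length z \<and> z ! i a = a" if "a \<in> set z" for a
    unfolding i_def using that by (intro someI_ex[where P = "\<lambda>j. j < length z \<and> z ! j = a"]) (simp add: in_set_conv_nth)
  define f where "f a = w ! i a" for a
  have len: "length w = length z"
    using assms(1) by (simp add: same_pattern_def)
  have pattern: "z ! x = z ! y \<longleftrightarrow> w ! x = w ! y" if "x < length z" "y < length z" for x y
    using assms(1) that by (simp add: same_pattern_def)
  have f: "f (z ! x) = w ! x" if "x < length z" for x
    using i[of "z ! x"] pattern[of "i (z ! x)" x] that by (simp add: f_def)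
  have "inj_on f (set z)"
  proof (rule inj_onI)
    fix a b assume ab: "a \<in> set z" "b \<in> set z" "f a = f b"
    then have "z ! i a = z ! i b"
      using i[OF ab(1)] i[OF ab(2)] pattern[of "i a" "i b"] by (simp add: f_def)
    then show "a = b"
      using i ab by simp
  qed
  moreover have "w = map f z"
    by (rule nth_equalityI) (simp_all add: f len)
  ultimately have "bij_betw f (set z) (set w)"
    by (simp add: bij_betw_def)
  then obtain \<sigma> where "\<sigma> permutes S" "\<And>x. x \<in> set z \<Longrightarrow> \<sigma> x = f x"
    using extend_to_permutation[OF assms(4,2,3)] by metis
  with \<open>w = map f z\<close> show thesis
    by (intro that[of \<sigma>]) (auto intro: map_cong)
qed

lemma invariant_same_pattern:
  assumes "invariant N k l F" "u \<in> words N k" "v \<in> words N l" "u' \<in> words N k" "v' \<in> words N l"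
    and "same_pattern (u @ rev v) (u' @ rev v')"
  shows "F u' v' = F u v"
proof -
  obtain \<sigma> where \<sigma>: "\<sigma> permutes {..<N}" "u' @ rev v' = map \<sigma> (u @ rev v)"
    using same_pattern_permutes[OF assms(6), of "{..<N}"] assms(2-5) by (auto simp: words_def)
  have "length u' = length (map \<sigma> u)"
    using assms(2,4) by (simp add: words_lengthD)
  with \<sigma>(2) have "u' = map \<sigma> u" "v' = map \<sigma> v"
    by (simp_all add: rev_map[symmetric])
  then show ?thesis
    using invariantD[OF assms(1) \<sigma>(1) assms(2,3)] by simp
qed

section \<open>The span of the partition matrices\<close>

lemma hom_P_submodule: "submodule class_ring (hom_P N k l) (mat_space (N ^ l) (N ^ k))"
proof -
  interpret matrix_vs "N ^ l" "N ^ k" "TYPE(complex)" .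
  have "{T N k l p | p. p \<in> two_row_partitions k l} \<subseteq> carrier_mat (N ^ l) (N ^ k)"
    by (auto simp: T_def)
  then show ?thesis
    unfolding hom_P_def by (rule span_is_submodule)
qed

lemma
  shows hom_P_add: "mat_of N k l F \<in> hom_P N k l \<Longrightarrow> mat_of N k l G \<in> hom_P N k l \<Longrightarrow>
      mat_of N k l (\<lambda>u v. F u v + G u v) \<in> hom_P N k l"
    and hom_P_scale: "mat_of N k l F \<in> hom_P N k l \<Longrightarrow> mat_of N k l (\<lambda>u v. c * F u v) \<in> hom_P N k l"
    and hom_P_zero: "mat_of N k l (\<lambda>u v. 0) \<in> hom_P N k l"
  using submodule.m_closed[OF hom_P_submodule, of "mat_of N k l F" N k l "mat_of N k l G"]
    submodule.smult_closed[OF hom_P_submodule, of c "mat_of N k l F" N k l]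
    submodule.zero_closed[OF hom_P_submodule, of N l k]
  by (simp_all add: matrix_vs_simps mat_of_add mat_of_smult mat_of_zero)

lemma hom_P_sum:
  assumes "finite I" "\<And>i. i \<in> I \<Longrightarrow> mat_of N k l (F i) \<in> hom_P N k l"
  shows "mat_of N k l (\<lambda>u v. \<Sum>i\<in>I. F i u v) \<in> hom_P N k l"
  using assms
proof (induction I)
  case (insert i I)
  then show ?case
    using hom_P_add[of N k l "F i" "\<lambda>u v. \<Sum>i\<in>I. F i u v"] by simp
qed (simp add: hom_P_zero)

lemma T_in_hom_P: "p \<in> two_row_partitions k l \<Longrightarrow> T N k l p \<in> hom_P N k l"
proof -
  assume p: "p \<in> two_row_partitions k l"
  interpret matrix_vs "N ^ l" "N ^ k" "TYPE(complex)" .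
  show ?thesis
    unfolding hom_P_def using p by (intro subsetD[OF in_own_span]) (auto simp: T_def)
qed

text \<open>Inclusion--exclusion over the required inequalities reduces patterns to partitions.\<close>

lemma constraints_in_hom_P:
  assumes "finite J" "E \<subseteq> {..<k + l} \<times> {..<k + l}" "J \<subseteq> {..<k + l} \<times> {..<k + l}"
  shows "mat_of N k l (\<lambda>u v. of_bool ((\<forall>(x, y)\<in>E. (u @ rev v) ! x = (u @ rev v) ! y) \<and>
    (\<forall>(x, y)\<in>J. (u @ rev v) ! x \<noteq> (u @ rev v) ! y))) \<in> hom_P N k l"
  using assms
proof (induction J arbitrary: E)
  case empty
  \<comment> \<open>\<open>h\<close> assigns to a point its class under the equivalence relation
    generated by \<open>E\<close>.\<close>
  define h where "h x = (E \<union> E\<inverse>)\<^sup>* `` {x}" for x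
  have "(\<forall>(x, y)\<in>E. z ! x = z ! y) \<longleftrightarrow> agree (k + l) h z" for z
  proof
    assume *: "\<forall>(x, y)\<in>E. z ! x = z ! y"
    have "z ! x = z ! y" if "h x = h y" for x y
    proof -
      have "(x, y) \<in> (E \<union> E\<inverse>)\<^sup>*"
        using that by (auto simp: h_def)
      then show ?thesis
        by induction (use * in auto)
    qed
    then show "agree (k + l) h z"
      unfolding agree_def by blast
  next
    assume *: "agree (k + l) h z"
    show "\<forall>(x, y)\<in>E. z ! x = z ! y"
    proof (intro ballI, clarify)
      fix x y assume xy: "(x, y) \<in> E"
      then have R: "(x, y) \<in> E \<union> E\<inverse>" "(y, x) \<in> E \<union> E\<inverse>" by auto
      have "(x, w) \<in> (E \<union> E\<inverse>)\<^sup>* \<longleftrightarrow> (y, w) \<in> (E \<union> E\<inverse>)\<^sup>*" for w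
        by (rule iffI) (erule converse_rtrancl_into_rtrancl[OF R(2)] converse_rtrancl_into_rtrancl[OF R(1)])+
      then have "h x = h y"
        by (simp add: h_def Image_def)
      with xy * empty show "z ! x = z ! y"
        by (auto simp: agree_def)
    qed
  qed
  then show ?case
    using T_in_hom_P[OF partition_fibres[of k l h]] by (simp add: T_fibres)
next
  case (insert e J)
  obtain a b where e: "e = (a, b)" by fastforce
  let ?c = "\<lambda>E J z. (\<forall>(x, y)\<in>E. z ! x = z ! y) \<and> (\<forall>(x, y)\<in>J. z ! x \<noteq> z ! y)"
  \<comment> \<open>Drop the inequality \<open>e\<close>, then subtract the words that violate it:
    for these \<open>e\<close> is imposed as an equality.\<close>
  have "of_bool (?c E (insert e J) z) = of_bool (?c E J z) + (- 1) * (of_bool (?c (insert e E) J z) :: complex)"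
    for z :: "nat list"
    by (auto simp: e)
  moreover have "mat_of N k l (\<lambda>u v. of_bool (?c E J (u @ rev v))) \<in> hom_P N k l"
    "mat_of N k l (\<lambda>u v. of_bool (?c (insert e E) J (u @ rev v))) \<in> hom_P N k l"
    by (rule insert.IH; use insert.prems in blast)+
  ultimately show ?case
    using hom_P_add[OF _ hom_P_scale[of N k l _ "- 1"]] by simp
qed

lemma same_pattern_in_hom_P:
  assumes "length z = k + l"
  shows "mat_of N k l (\<lambda>u v. of_bool (same_pattern z (u @ rev v))) \<in> hom_P N k l"
proof -
  let ?n = "k + l"
  let ?E = "{(x, y). x < ?n \<and> y < ?n \<and> z ! x = z ! y}" and ?J = "{(x, y). x < ?n \<and> y < ?n \<and> z ! x \<noteq> z ! y}"
  have fin: "?E \<subseteq> {..<?n} \<times> {..<?n}" "?J \<subseteq> {..<?n} \<times> {..<?n}"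
    by auto
  have "mat_of N k l (\<lambda>u v. of_bool (same_pattern z (u @ rev v))) =
    mat_of N k l (\<lambda>u v. of_bool ((\<forall>(x, y)\<in>?E. (u @ rev v) ! x = (u @ rev v) ! y) \<and>
      (\<forall>(x, y)\<in>?J. (u @ rev v) ! x \<noteq> (u @ rev v) ! y)))"
  proof (rule mat_of_cong)
    fix u v assume "u \<in> words N k" "v \<in> words N l"
    then have "length (u @ rev v) = ?n" by (simp add: words_lengthD)
    then show "of_bool (same_pattern z (u @ rev v)) = (of_bool ((\<forall>(x, y)\<in>?E. (u @ rev v) ! x = (u @ rev v) ! y) \<and>
      (\<forall>(x, y)\<in>?J. (u @ rev v) ! x \<noteq> (u @ rev v) ! y)) :: complex)"
      unfolding same_pattern_def using assms by (intro arg_cong[where f = of_bool]) auto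
  qed
  with constraints_in_hom_P[OF finite_subset[OF fin(2)] fin] show ?thesis
    by simp
qed

lemma same_pattern_cong: "same_pattern z w \<Longrightarrow> same_pattern z z' \<longleftrightarrow> same_pattern w z'"
  by (auto simp: same_pattern_def)

text \<open>An invariant function is constant on orbits, hence a combination of indicators of
  patterns.\<close>

lemma invariant_in_hom_P:
  assumes "invariant N k l F"
  shows "mat_of N k l F \<in> hom_P N k l"
proof -
  let ?W = "words N k \<times> words N l"
  let ?z = "\<lambda>(u, v). u @ rev v"
  \<comment> \<open>The sum below runs over all pairs of words instead of orbit representatives, so
    each orbit is counted once per element; dividing by its size \<open>n p\<close> corrects
    this.\<close>
  define n where "n p = card {p'\<in>?W. same_pattern (?z p) (?z p')}" for p
  define G where "G p u v = F (fst p) (snd p) / n p * of_bool (same_pattern (?z p) (u @ rev v))" for p u v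
  have "mat_of N k l F = mat_of N k l (\<lambda>u v. \<Sum>p\<in>?W. G p u v)"
  proof (rule mat_of_cong)
    fix u v assume uv: "u \<in> words N k" "v \<in> words N l"
    let ?S = "{p\<in>?W. same_pattern (u @ rev v) (?z p)}"
    have sym: "same_pattern z w \<longleftrightarrow> same_pattern w z" for z w :: "nat list"
      by (auto simp: same_pattern_def)
    have "(u, v) \<in> ?S"
      using uv by (simp add: same_pattern_def)
    then have "card ?S \<noteq> 0"
      by (subst card_0_eq) auto
    have eq: "F (fst p) (snd p) = F u v" "n p = card ?S" if "p \<in> ?S" for p
    proof -
      show "F (fst p) (snd p) = F u v"
        using invariant_same_pattern[OF assms uv, of "fst p" "snd p"] that by (auto simp: case_prod_beta)
      show "n p = card ?S"
        unfolding n_def using that same_pattern_cong[of "u @ rev v" "?z p"] by simp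
    qed
    have "(\<Sum>p\<in>?W. G p u v) = (\<Sum>p\<in>?W. if same_pattern (u @ rev v) (?z p) then F (fst p) (snd p) / n p else 0)"
      unfolding G_def by (intro sum.cong refl) (simp add: sym[of "u @ rev v"])
    also have "\<dots> = (\<Sum>p\<in>?S. F (fst p) (snd p) / n p)"
      by (rule sum.inter_filter[symmetric]) simp
    also have "\<dots> = (\<Sum>p\<in>?S. F u v / card ?S)"
      by (rule sum.cong) (simp_all add: eq del: mem_Collect_eq)
    also have "\<dots> = F u v"
      using \<open>card ?S \<noteq> 0\<close> by simp
    finally show "F u v = (\<Sum>p\<in>?W. G p u v)" ..
  qed
  also have "\<dots> \<in> hom_P N k l"
  proof (rule hom_P_sum)
    fix p assume "p \<in> ?W"
    then have "length (?z p) = k + l"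
      by (auto simp: words_lengthD)
    then show "mat_of N k l (G p) \<in> hom_P N k l"
      unfolding G_def by (intro hom_P_scale same_pattern_in_hom_P)
  qed simp
  finally show ?thesis .
qed

text \<open>An injective relabelling preserves and reflects equality of letters, so each
  \<open>T\<close> is invariant, and invariance is a linear condition.\<close>

lemma hom_P_invariantE:
  assumes "A \<in> hom_P N k l"
  obtains F where "A = mat_of N k l F" "invariant N k l F"
proof -
  interpret matrix_vs "N ^ l" "N ^ k" "TYPE(complex)" .
  let ?S = "{mat_of N k l F | F. invariant N k l F}"
  have "submodule class_ring ?S V"
  proof (rule submodule.intro)
    show "Module.module class_ring V" by (rule module_axioms)
    show "?S \<subseteq> carrier V" by (auto simp: matrix_vs_simps)
    show "\<zero>\<^bsub>V\<^esub> \<in> ?S"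
      by (auto simp: matrix_vs_simps mat_of_zero invariant_def intro!: exI[of _ "\<lambda>_ _. 0"])
    show "v \<oplus>\<^bsub>V\<^esub> w \<in> ?S" if v: "v \<in> ?S" and w: "w \<in> ?S" for v w
    proof -
      obtain F where "v = mat_of N k l F" "invariant N k l F"
        using v by blast
      moreover obtain G where "w = mat_of N k l G" "invariant N k l G"
        using w by blast
      ultimately show ?thesis
        by (auto simp: matrix_vs_simps mat_of_add invariant_def intro!: exI[of _ "\<lambda>u v. F u v + G u v"])
    qed
    show "c \<odot>\<^bsub>V\<^esub> v \<in> ?S" if v: "v \<in> ?S" for c v
    proof -
      obtain F where "v = mat_of N k l F" "invariant N k l F"
        using v by blast
      then show ?thesis
        by (auto simp: matrix_vs_simps mat_of_smult invariant_def intro!: exI[of _ "\<lambda>u v. c * F u v"])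
    qed
  qed
  moreover have "T N k l p \<in> ?S" if p: "p \<in> two_row_partitions k l" for p
  proof -
    have "partition_on (points k l) p"
      using p by (simp add: two_row_partitions_def points_def)
    then obtain h :: "nat \<Rightarrow> nat" where
      T: "T N k l p = mat_of N k l (\<lambda>u v. of_bool (agree (k + l) h (u @ rev v)))"
      by (rule T_labels)
    have "invariant N k l (\<lambda>u v. of_bool (agree (k + l) h (u @ rev v)))"
    proof (rule invariantI)
      fix \<sigma> u v assume \<sigma>: "\<sigma> permutes {..<N}" and uv: "u \<in> words N k" "v \<in> words N l"
      have "map \<sigma> u @ rev (map \<sigma> v) = map \<sigma> (u @ rev v)" "length (u @ rev v) = k + l"
        using uv by (simp_all add: rev_map words_lengthD)
      then show "of_bool (agree (k + l) h (map \<sigma> u @ rev (map \<sigma> v))) =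
        (of_bool (agree (k + l) h (u @ rev v)) :: complex)"
        using permutes_inj[OF \<sigma>] by (simp add: agree_def inj_eq del: map_append rev_append)
    qed
    with T show ?thesis by blast
  qed
  ultimately have "hom_P N k l \<subseteq> ?S"
    unfolding hom_P_def by (intro span_is_subset) auto
  with assms that show thesis by blast
qed

text \<open>Every operation of a dual preserves invariance, and the two passages between invariants
  and \<open>hom_P\<close> transport this.\<close>

lemma tk_dual_hom_P: "tk_dual N (hom_P N)"
  unfolding tk_dual_def
proof (intro conjI allI ballI)
  fix k l
  interpret matrix_vs "N ^ l" "N ^ k" "TYPE(complex)" .
  show "VectorSpace.subspace class_ring (hom_P N k l) V"
    by (simp add: VectorSpace.subspace_def vectorspace_axioms hom_P_submodule)
next
  fix k l k' l' A B
  assume "A \<in> hom_P N k l" "B \<in> hom_P N k' l'"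
  then obtain F G where *: "A = mat_of N k l F" "invariant N k l F" "B = mat_of N k' l' G" "invariant N k' l' G"
    by (metis hom_P_invariantE)
  have "invariant N (k + k') (l + l') (\<lambda>u v. F (take k u) (take l v) * G (drop k u) (drop l v))"
    by (rule invariantI)
      (simp add: take_map drop_map invariantD[OF *(2)] invariantD[OF *(4)] words_take words_drop)
  then show "kron A B \<in> hom_P N (k + k') (l + l')"
    by (simp add: * mat_of_kron invariant_in_hom_P)
next
  fix k l n A B
  assume "A \<in> hom_P N k l" "B \<in> hom_P N l n"
  then obtain F G where *: "A = mat_of N k l F" "invariant N k l F" "B = mat_of N l n G" "invariant N l n G"
    by (metis hom_P_invariantE)
  have "invariant N k n (\<lambda>u w. \<Sum>v\<in>words N l. F u v * G v w)"
  proof (rule invariantI)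
    fix \<sigma> u w assume \<sigma>: "\<sigma> permutes {..<N}" and uw: "u \<in> words N k" "w \<in> words N n"
    \<comment> \<open>The intermediate words are permuted along with \<open>u\<close> and
      \<open>w\<close>.\<close>
    have "(\<Sum>v\<in>words N l. F (map \<sigma> u) v * G v (map \<sigma> w)) =
        (\<Sum>v\<in>words N l. F (map \<sigma> u) (map \<sigma> v) * G (map \<sigma> v) (map \<sigma> w))"
      by (rule sum_map_permutes[OF \<sigma>, symmetric])
    also have "\<dots> = (\<Sum>v\<in>words N l. F u v * G v w)"
      using uw by (intro sum.cong refl) (simp add: invariantD[OF *(2) \<sigma>] invariantD[OF *(4) \<sigma>])
    finally show "(\<Sum>v\<in>words N l. F (map \<sigma> u) v * G v (map \<sigma> w)) = (\<Sum>v\<in>words N l. F u v * G v w)" .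
  qed
  then show "B * A \<in> hom_P N k n"
    by (simp add: * mat_of_mult invariant_in_hom_P)
next
  fix k l A
  assume "A \<in> hom_P N k l"
  then obtain F where *: "A = mat_of N k l F" "invariant N k l F"
    by (rule hom_P_invariantE)
  then have "invariant N l k (\<lambda>u v. cnj (F v u))"
    by (simp add: invariant_def)
  then show "mat_adjoint A \<in> hom_P N l k"
    by (simp add: * mat_of_adjoint invariant_in_hom_P)
next
  have "invariant N 1 1 (\<lambda>u v. of_bool (u = v))"
    by (rule invariantI) (simp add: map_permutes_inj)
  then show "1\<^sub>m N \<in> hom_P N 1 1"
    unfolding one_mat_of by (rule invariant_in_hom_P)
next
  have "invariant N 2 0 (\<lambda>u v. of_bool (u ! 0 = u ! 1))"
  proof (rule invariantI)
    fix \<sigma> u and v :: "nat list" assume "\<sigma> permutes {..<N}" "u \<in> words N 2"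
    then show "of_bool (map \<sigma> u ! 0 = map \<sigma> u ! 1) = (of_bool (u ! 0 = u ! 1) :: complex)"
      by (simp add: words_lengthD inj_eq[OF permutes_inj])
  qed
  then show "mat 1 (N ^ 2) (\<lambda>(_, b). if digit N 2 b 1 = digit N 2 b 2 then 1 else 0) \<in> hom_P N 2 0"
    unfolding cap_mat_of by (rule invariant_in_hom_P)
qed

lemma hom_NC_subset_hom_P: "hom_NC N k l \<subseteq> hom_P N k l"
proof -
  interpret matrix_vs "N ^ l" "N ^ k" "TYPE(complex)" .
  show ?thesis
    unfolding hom_NC_def hom_P_def by (rule span_is_monotone) auto
qed

lemma xi_in_hom_P: "partition_on {1..k} p \<Longrightarrow> xi N k p \<in> hom_P N 0 k"
  unfolding xi_eq_T
proof (rule T_in_hom_P)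
  assume p: "partition_on {1..k} p"
  have "{1..0::nat} <+> {1..k} = (Inr ` {1..k} :: (nat + nat) set)"
    by auto
  moreover have "(`) Inr ` p - {{}} = ((`) Inr ` p :: (nat + nat) set set)"
    using partition_onD3[OF p] by auto
  ultimately show "(`) Inr ` p \<in> two_row_partitions 0 k"
    using partition_on_inj_image[OF p, of "Inr :: nat \<Rightarrow> nat + nat"] by (simp add: two_row_partitions_def)
qed

theorem theoremB:
  fixes N k m :: nat
    and \<alpha> :: "nat \<Rightarrow> complex"
    and p :: "nat \<Rightarrow> nat set set"
    and \<xi> :: "complex mat"
  assumes "N \<ge> 1" and "k \<ge> 1"
    and "\<And>i. i \<in> {1..m} \<Longrightarrow> p i \<in> CR k"
    and "\<And>i j. i \<in> {1..m} \<Longrightarrow> j \<in> {1..m} \<Longrightarrow> cr (p i) = cr (p j)"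
    and "\<xi> = finsum (mat_space (N ^ k) 1) (\<lambda>i. \<alpha> i \<cdot>\<^sub>m xi N k (p i)) {1..m}"
    and "\<xi> \<noteq> 0\<^sub>m (N ^ k) 1"
  shows "tk_generated N (hom_NC N) k \<xi> = hom_P N"
proof (intro ext subset_antisym)
  fix k' l'
  have part: "partition_on {1..k} (p i)" if "i \<in> {1..m}" for i
    using assms(3)[OF that] by (simp add: CR_def)
  have \<xi>: "\<xi> = mat_of N 0 k (\<lambda>_ v. \<Sum>i\<in>{1..m}. \<alpha> i * of_bool (agree k (\<lambda>x. block_of (p i) (x + 1)) v))"
    unfolding assms(5) by (rule finsum_xi[OF finite_atLeastAtMost part])
  have "\<xi> \<in> hom_P N 0 k"
    unfolding \<xi>
  proof (intro hom_P_sum hom_P_scale)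
    fix i assume "i \<in> {1..m}"
    then show "mat_of N 0 k (\<lambda>_ v. of_bool (agree k (\<lambda>x. block_of (p i) (x + 1)) v)) \<in> hom_P N 0 k"
      using xi_in_hom_P[OF part] by (simp only: xi_mat_of[OF part])
  qed simp
  then show "tk_generated N (hom_NC N) k \<xi> k' l' \<subseteq> hom_P N k' l'"
    by (intro tk_generated_least tk_dual_hom_P hom_NC_subset_hom_P)
  show "hom_P N k' l' \<subseteq> tk_generated N (hom_NC N) k \<xi> k' l'"
  proof
    fix A assume A: "A \<in> hom_P N k' l'"
    \<comment> \<open>The generated dual is an intersection, so P has to be found inside every
      competing \<open>C\<close>.\<close>
    have "A \<in> C k' l'" if C: "tk_dual N C" "\<And>k' l'. hom_NC N k' l' \<subseteq> C k' l'" "\<xi> \<in> C 0 k" for C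
    proof -
      interpret dual_over_NC N C
        using C assms(1) by unfold_locales
      have "in_hom 0 4 (\<lambda>_ w. of_bool (crossing_word w))"
        by (rule hom_crossing_if_same_crossings[OF assms(3) finite_atLeastAtMost assms(4,5) C(3) assms(6)])
      then interpret dual_with_crossing N C
        by unfold_locales
      show ?thesis
        using hom_P_subset A by blast
    qed
    then show "A \<in> tk_generated N (hom_NC N) k \<xi> k' l'"
      by (simp add: mem_tk_generated)
  qed
qed

end
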